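(* Let $(U,\langle\cdot,\cdot\rangle_U;J)$ and $(\widetilde U,\langle\cdot,\cdot\rangle_{\widetilde U};\widetilde J)$ be admissible modules, with their representation maps, of the Clifford algebras $\mathrm{Cl}_{r,s}$ and $\mathrm{Cl}_{\tilde r,\tilde s}$ respectively. Assume that $\dim U=\dim\widetilde U$, $r+s=\tilde r+\tilde s$, and that there is a Lie algebra isomorphism $\Phi\colon\mathcal N_{r,s}(U)\to\mathcal N_{\tilde r,\tilde s}(\widetilde U)$ between the corresponding pseudo $H$-type algebras. Then necessarily $(r,s)=(\tilde r,\tilde s)$ or $(r,s)=(\tilde s,\tilde r)$. Moreover, $\Phi$ has to be of the form $$\Phi=\begin{pmatrix}A&0\\ B&C\end{pmatrix}\colon U\oplus\mathbb R^{r,s}\to\widetilde U\oplus\mathbb R^{\tilde r,\tilde s},$$ where $A\colon U\to\widetilde U$ and $C\colon\mathbb R^{r,s}\to\mathbb R^{\tilde r,\tilde s}$ are linear bijective maps satisfying $$A^{\tau}\widetilde J_zA=J_{C^{\tau}(z)}\quad\text{for any } z\in\mathbb R^{\tilde r,\tilde s}.$$ There is no condition on the linear map $B\colon U\to\mathbb R^{\tilde r,\tilde s}$, and one may set $B=0$. Multiplying $A$ by a suitable nonzero constant $c$ (and $C$ correspondingly by $c^2$), one may assume that $|\det(AA^{\tau})|=1$ and $CC^{\tau}=\pm\mathrm{Id}$.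
   Context: $\mathbb R^{r,s}$ denotes $\mathbb R^{r+s}$ with the symmetric bilinear form $\langle x,y\rangle_{r,s}=\sum_{i=1}^r x_iy_i-\sum_{j=1}^s x_{r+j}y_{r+j}$, and $\mathrm{Cl}_{r,s}$ is the Clifford algebra it generates with the convention $x\otimes x=-\langle x,x\rangle_{r,s}$. A $\mathrm{Cl}_{r,s}$-module is a finite-dimensional real vector space $U$ with a linear map $J\colon\mathbb R^{r,s}\to\mathrm{End}(U)$ such that $J_z^2=-\langle z,z\rangle_{r,s}\mathrm{Id}_U$ for all $z$. It is admissible if it is equipped with a non-degenerate symmetric bilinear form (scalar product) $\langle\cdot,\cdot\rangle_U$ with $\langle J_zx,y\rangle_U+\langle x,J_zy\rangle_U=0$ for all $z\in\mathbb R^{r,s}$, $x,y\in U$. The pseudo $H$-type Lie algebra $\mathcal N_{r,s}(U)$ is the 2-step nilpotent Lie algebra $U\oplus\mathbb R^{r,s}$ with centre $\mathbb R^{r,s}$ and bracket $[U,U]\subset\mathbb R^{r,s}$ determined by $\langle J_zx,y\rangle_U=\langle z,[x,y]\rangle_{r,s}$ for $z\in\mathbb R^{r,s}$, $x,y\in U$. For a linear map between scalar product spaces, the superscript $\tau$ denotes the adjoint with respect to the scalar products: $\langle A(x),y\rangle_{\widetilde U}=\langle x,A^{\tau}(y)\rangle_U$, and similarly for $C$ with respect to $\langle\cdot,\cdot\rangle_{r,s}$ and $\langle\cdot,\cdot\rangle_{\tilde r,\tilde s}$. *)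

theory Defs
  imports Complex_Main "HOL-Library.Product_Plus" "Jordan_Normal_Form.Determinant"
begin

text \<open>The space \<open>\<real>\<^sup>n\<close> is \<open>carrier_vec n :: real vec set\<close>, so that \<open>n = r + s\<close> may be any
  natural number, including \<open>0\<close>. Indices start at \<open>0\<close>.\<close>

definition scalar_rs :: "nat \<Rightarrow> nat \<Rightarrow> real vec \<Rightarrow> real vec \<Rightarrow> real" where
  "scalar_rs r s x y = (\<Sum>i<r. x $ i * y $ i) - (\<Sum>j<s. x $ (r + j) * y $ (r + j))"

text \<open>Linearity on an explicit carrier. The scalar multiplications of the domain and of the
  codomain are arguments, because \<open>real vec\<close> is not an instance of \<open>real_vector\<close>.\<close>

definition linear_on ::
  "'a::plus set \<Rightarrow> (real \<Rightarrow> 'a \<Rightarrow> 'a) \<Rightarrow> (real \<Rightarrow> 'b::plus \<Rightarrow> 'b) \<Rightarrow> ('a \<Rightarrow> 'b) \<Rightarrow> bool" where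
  "linear_on S scl scl' f \<longleftrightarrow>
     (\<forall>x\<in>S. \<forall>y\<in>S. f (x + y) = f x + f y) \<and> (\<forall>c. \<forall>x\<in>S. f (scl c x) = scl' c (f x))"

definition finite_dimensional :: "'u::real_vector itself \<Rightarrow> bool" where
  "finite_dimensional _ \<longleftrightarrow> (\<exists>B :: 'u set. finite B \<and> span B = UNIV)"

definition clifford_module ::
  "nat \<Rightarrow> nat \<Rightarrow> (real vec \<Rightarrow> 'u::real_vector \<Rightarrow> 'u) \<Rightarrow> bool" where
  "clifford_module r s J \<longleftrightarrow>
     finite_dimensional TYPE('u) \<and>
     (\<forall>z \<in> carrier_vec (r + s). linear (J z)) \<and>
     (\<forall>x. linear_on (carrier_vec (r + s)) (\<cdot>\<^sub>v) (*\<^sub>R) (\<lambda>z. J z x)) \<and>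
     (\<forall>z \<in> carrier_vec (r + s). \<forall>x. J z (J z x) = - scalar_rs r s z z *\<^sub>R x)"

definition scalar_product :: "('u::real_vector \<Rightarrow> 'u \<Rightarrow> real) \<Rightarrow> bool" where
  "scalar_product b \<longleftrightarrow>
     (\<forall>x. linear (\<lambda>y. b x y)) \<and> (\<forall>y. linear (\<lambda>x. b x y)) \<and>
     (\<forall>x y. b x y = b y x) \<and>
     (\<forall>x. (\<forall>y. b x y = 0) \<longrightarrow> x = 0)"

definition admissible_module ::
  "nat \<Rightarrow> nat \<Rightarrow> ('u::real_vector \<Rightarrow> 'u \<Rightarrow> real) \<Rightarrow> (real vec \<Rightarrow> 'u \<Rightarrow> 'u) \<Rightarrow> bool" where
  "admissible_module r s b J \<longleftrightarrow>
     clifford_module r s J \<and> scalar_product b \<and>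
     (\<forall>z \<in> carrier_vec (r + s). \<forall>x y. b (J z x) y + b x (J z y) = 0)"

record 'a real_lie_algebra =
  lie_carrier :: "'a set"
  lie_scale :: "real \<Rightarrow> 'a \<Rightarrow> 'a"
  lie_bracket :: "'a \<Rightarrow> 'a \<Rightarrow> 'a"

definition lie_algebra_iso ::
  "'a::plus real_lie_algebra \<Rightarrow> 'b::plus real_lie_algebra \<Rightarrow> ('a \<Rightarrow> 'b) \<Rightarrow> bool" where
  "lie_algebra_iso L M f \<longleftrightarrow>
     bij_betw f (lie_carrier L) (lie_carrier M) \<and>
     linear_on (lie_carrier L) (lie_scale L) (lie_scale M) f \<and>
     (\<forall>x \<in> lie_carrier L. \<forall>y \<in> lie_carrier L.
        f (lie_bracket L x y) = lie_bracket M (f x) (f y))"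

text \<open>The \<open>\<real>\<^sup>r\<^sup>,\<^sup>s\<close>-valued bracket on \<open>U\<close>. For an admissible module the described vector exists
  and is unique, because \<open>scalar_rs r s\<close> is non-degenerate on \<open>carrier_vec (r + s)\<close>.\<close>

definition h_bracket ::
  "nat \<Rightarrow> nat \<Rightarrow> ('u \<Rightarrow> 'u \<Rightarrow> real) \<Rightarrow> (real vec \<Rightarrow> 'u \<Rightarrow> 'u) \<Rightarrow> 'u \<Rightarrow> 'u \<Rightarrow> real vec" where
  "h_bracket r s b J x y =
     (THE w. w \<in> carrier_vec (r + s) \<and>
        (\<forall>z \<in> carrier_vec (r + s). b (J z x) y = scalar_rs r s z w))"

definition pseudo_H_type ::
  "nat \<Rightarrow> nat \<Rightarrow> ('u::real_vector \<Rightarrow> 'u \<Rightarrow> real) \<Rightarrow> (real vec \<Rightarrow> 'u \<Rightarrow> 'u)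
    \<Rightarrow> ('u \<times> real vec) real_lie_algebra" where
  "pseudo_H_type r s b J =
     \<lparr> lie_carrier = UNIV \<times> carrier_vec (r + s),
       lie_scale = (\<lambda>c (x, z). (c *\<^sub>R x, c \<cdot>\<^sub>v z)),
       lie_bracket = (\<lambda>(x, z) (y, w). (0, h_bracket r s b J x y)) \<rparr>"

text \<open>The adjoint of \<open>A\<close> from \<open>(X, b)\<close> to a space with form \<open>b'\<close>: for all \<open>x \<in> X\<close>,
  \<open>b' (A x) y = b x (form_adjoint X b b' A y)\<close>. It is well defined for linear \<open>A\<close> if \<open>X\<close> is
  finite-dimensional and \<open>b\<close> is non-degenerate on \<open>X\<close>.\<close>

definition form_adjoint ::
  "'a set \<Rightarrow> ('a \<Rightarrow> 'a \<Rightarrow> real) \<Rightarrow> ('b \<Rightarrow> 'b \<Rightarrow> real) \<Rightarrow> ('a \<Rightarrow> 'b) \<Rightarrow> 'b \<Rightarrow> 'a" where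
  "form_adjoint X b b' A y = (THE u. u \<in> X \<and> (\<forall>x\<in>X. b' (A x) y = b x u))"

text \<open>The determinant of an endomorphism of a finite-dimensional space, computed from its matrix
  with respect to some basis; the value does not depend on the basis.\<close>

definition some_basis :: "'u::real_vector itself \<Rightarrow> 'u list" where
  "some_basis _ = (SOME bs. distinct bs \<and> independent (set bs) \<and> span (set bs) = (UNIV :: 'u set))"

definition endo_det :: "('u::real_vector \<Rightarrow> 'u) \<Rightarrow> real" where
  "endo_det f =
     (let bs = some_basis TYPE('u); n = length bs
      in det (mat n n (\<lambda>(i, j). representation (set bs) (f (bs ! j)) (bs ! i))))"

definition block_map ::
  "('u \<Rightarrow> 'v) \<Rightarrow> ('u \<Rightarrow> real vec) \<Rightarrow> (real vec \<Rightarrow> real vec) \<Rightarrow> 'u \<times> real vec \<Rightarrow> 'v \<times> real vec" where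
  "block_map A B C = (\<lambda>(x, z). (A x, B x + C z))"

end

theory Submission
  imports Defs
begin

text \<open>For \<open>r + s > 0\<close> the centre of a pseudo \<open>H\<close>-type algebra is exactly \<open>\<real>\<^sup>r\<^sup>,\<^sup>s\<close>, because \<open>J\<^sub>z\<close> is
  invertible for non-isotropic \<open>z\<close>; so \<open>\<Phi>\<close> is block triangular, and the relation
  \<open>A\<^sup>\<tau> J'\<^sub>z A = J\<^sub>w\<close> with \<open>w = C\<^sup>\<tau> z\<close> restates that \<open>\<Phi>\<close> preserves brackets. Rescale \<open>A\<close> so that
  \<open>A A\<^sup>\<tau>\<close> has determinant \<open>\<plusminus>1\<close>. Since \<open>J\<^sub>w\<^sup>2\<close> and \<open>J'\<^sub>z\<^sup>2\<close> are scalar, squaring the determinants of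
  both sides gives \<open>\<bar>\<langle>w, w\<rangle>\<bar> = \<bar>\<langle>z, z\<rangle>\<bar>\<close>. The product of the quadratic forms
  \<open>\<langle>w, w\<rangle> - \<langle>z, z\<rangle>\<close> and \<open>\<langle>w, w\<rangle> + \<langle>z, z\<rangle>\<close> thus vanishes, hence one of the factors does. Polarisation
  yields \<open>C C\<^sup>\<tau> = \<plusminus>1\<close>, and Sylvester's law of inertia compares the signatures.\<close>

subsection \<open>Linear functionals on coordinate spaces\<close>

abbreviation functional_on :: "nat \<Rightarrow> (real vec \<Rightarrow> real) \<Rightarrow> bool" where
  "functional_on n g \<equiv> linear_on (carrier_vec n) (\<cdot>\<^sub>v) (*) g"

lemma linear_on_add:
  "linear_on S scl scl' f \<Longrightarrow> x \<in> S \<Longrightarrow> y \<in> S \<Longrightarrow> f (x + y) = f x + f y"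
  by (simp add: linear_on_def)

lemma linear_on_scale: "linear_on S scl scl' f \<Longrightarrow> x \<in> S \<Longrightarrow> f (scl c x) = scl' c (f x)"
  by (simp add: linear_on_def)

lemma linear_on_carrier_vec_0:
  assumes "linear_on (carrier_vec n) (\<cdot>\<^sub>v) scl f" "\<And>v. scl 0 v = w"
  shows "f (0\<^sub>v n) = w"
proof -
  have "0 \<cdot>\<^sub>v 0\<^sub>v n = (0\<^sub>v n :: real vec)" by auto
  then show ?thesis
    using linear_on_scale[OF assms(1), of "0\<^sub>v n" 0] assms(2) by simp
qed

lemma functional_on_expand:
  assumes g: "functional_on n g" and z: "z \<in> carrier_vec n"
  shows "g z = (\<Sum>i<n. z $ i * g (unit_vec n i))"
proof -
  \<comment> \<open>Induction on the number \<open>k\<close> of coordinates kept in a truncation of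
    \<open>z\<close>; in this way only real numbers have to be summed.\<close>
  have "g (vec n (\<lambda>i. if i < k then z $ i else 0)) = (\<Sum>i<k. z $ i * g (unit_vec n i))"
    if "k \<le> n" for k
    using that
  proof (induction k)
    case 0
    have "vec n (\<lambda>i. if i < 0 then z $ i else 0) = 0\<^sub>v n" by auto
    moreover have "g (0\<^sub>v n) = 0" by (rule linear_on_carrier_vec_0[OF g]) simp
    ultimately show ?case by (metis sum.empty lessThan_0)
  next
    case (Suc k)
    have "vec n (\<lambda>i. if i < Suc k then z $ i else 0)
        = vec n (\<lambda>i. if i < k then z $ i else 0) + z $ k \<cdot>\<^sub>v unit_vec n k"
      using Suc.prems by (intro eq_vecI) (auto simp: less_Suc_eq)
    then show ?case
      using Suc linear_on_add[OF g] linear_on_scale[OF g] by simp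
  qed
  from this[of n] have "g (vec n (\<lambda>i. if i < n then z $ i else 0)) = (\<Sum>i<n. z $ i * g (unit_vec n i))"
    by simp
  moreover have "vec n (\<lambda>i. if i < n then z $ i else 0) = z"
    using z by (intro eq_vecI) auto
  ultimately show ?thesis by simp
qed

lemma functional_on_index: "i < n \<Longrightarrow> functional_on n (\<lambda>z. z $ i)"
  by (auto simp: linear_on_def)

lemma functional_on_compose_index:
  assumes T: "linear_on (carrier_vec m) (\<cdot>\<^sub>v) (\<cdot>\<^sub>v) T" "\<And>z. z \<in> carrier_vec m \<Longrightarrow> T z \<in> carrier_vec n"
    and "i < n"
  shows "functional_on m (\<lambda>z. T z $ i)"
  unfolding linear_on_def
proof (intro conjI ballI allI)
  fix x y :: "real vec" assume x: "x \<in> carrier_vec m" and y: "y \<in> carrier_vec m"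
  show "T (x + y) $ i = T x $ i + T y $ i"
    using linear_on_add[OF T(1) x y] T(2)[OF x] T(2)[OF y] assms(3) by auto
next
  fix c and x :: "real vec" assume x: "x \<in> carrier_vec m"
  show "T (c \<cdot>\<^sub>v x) $ i = c * T x $ i"
    using linear_on_scale[OF T(1) x] T(2)[OF x] assms(3) by auto
qed

section \<open>Common zeros of functionals and Sylvester's law of inertia\<close>

lemma exists_common_zero:
  assumes "m < n" and g: "\<And>i. i < m \<Longrightarrow> functional_on n (g i)"
  shows "\<exists>z \<in> carrier_vec n. z \<noteq> 0\<^sub>v n \<and> (\<forall>i<m. g i z = 0)"
proof -
  \<comment> \<open>Padding the \<open>m\<close> coefficient rows with zero rows makes the matrix
    square. Row \<open>m\<close> is zero because \<open>m < n\<close>, so the determinant vanishes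
    and the kernel contains a nonzero vector.\<close>
  define M where "M = mat n n (\<lambda>(i, j). if i < m then g i (unit_vec n j) else 0)"
  have M: "M \<in> carrier_mat n n" by (simp add: M_def)
  have "row M m = 0\<^sub>v n"
    using assms(1) by (intro eq_vecI) (auto simp: M_def)
  then have "mat\<^sub>r n n (\<lambda>i. if i = m then 0\<^sub>v n else row M i) = M"
    using M by (intro eq_rowI) auto
  then have "det M = 0"
    using det_row_0[OF assms(1), of "row M"] M by auto
  then obtain v where v: "v \<in> carrier_vec n" "v \<noteq> 0\<^sub>v n" "M *\<^sub>v v = 0\<^sub>v n"
    using det_0_iff_vec_prod_zero[OF M] by auto
  have "g i v = 0" if i: "i < m" for i
  proof -
    have "g i v = (\<Sum>j<n. v $ j * g i (unit_vec n j))"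
      by (rule functional_on_expand[OF g[OF i] v(1)])
    also have "\<dots> = (M *\<^sub>v v) $ i"
      using i assms(1) v(1)
      by (simp add: M_def scalar_prod_def mult.commute lessThan_atLeast0)
    finally show ?thesis using v(3) i assms(1) by simp
  qed
  then show ?thesis using v by blast
qed

text \<open>Otherwise \<open>p + q' < n\<close>, so all \<open>f i\<close> and all
  \<open>h' i\<close> have a common zero \<open>z\<close> other than the zero vector. At this
  \<open>z\<close> the left side of \<open>eq\<close> is at most 0 and the right side is at least 0;
  hence the \<open>f' i\<close> vanish there as well, against \<open>sep\<close>.\<close>

lemma inertia_le:
  fixes f f' h h' :: "nat \<Rightarrow> real vec \<Rightarrow> real"
  assumes n: "n = p' + q'"
    and f: "\<And>i. i < p \<Longrightarrow> functional_on n (f i)"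
    and h': "\<And>i. i < q' \<Longrightarrow> functional_on n (h' i)"
    and eq: "\<And>z. z \<in> carrier_vec n \<Longrightarrow>
      (\<Sum>i<p. (f i z)\<^sup>2) - (\<Sum>i<q. (h i z)\<^sup>2) = (\<Sum>i<p'. (f' i z)\<^sup>2) - (\<Sum>i<q'. (h' i z)\<^sup>2)"
    and sep: "\<And>z. z \<in> carrier_vec n \<Longrightarrow> \<forall>i<p'. f' i z = 0 \<Longrightarrow> \<forall>i<q'. h' i z = 0 \<Longrightarrow> z = 0\<^sub>v n"
  shows "p' \<le> p"
proof (rule ccontr)
  assume "\<not> p' \<le> p"
  then have less: "p + q' < n" using n by simp
  define g where "g i = (if i < p then f i else h' (i - p))" for i
  have "functional_on n (g i)" if "i < p + q'" for i
    using that f h' by (auto simp: g_def)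
  then obtain z where z: "z \<in> carrier_vec n" "z \<noteq> 0\<^sub>v n"
    and gz: "\<And>i. i < p + q' \<Longrightarrow> g i z = 0"
    using exists_common_zero[OF less] by blast
  have fz: "f i z = 0" if "i < p" for i
    using gz[of i] that by (simp add: g_def)
  have hz: "h' i z = 0" if "i < q'" for i
    using gz[of "p + i"] that by (simp add: g_def)
  have "(\<Sum>i<p'. (f' i z)\<^sup>2) = - (\<Sum>i<q. (h i z)\<^sup>2)"
    using eq[OF z(1)] fz hz by simp
  also have "\<dots> \<le> 0" by (simp add: sum_nonneg)
  finally have "(\<Sum>i<p'. (f' i z)\<^sup>2) = 0" by (simp add: sum_nonneg antisym)
  then have "\<forall>i<p'. f' i z = 0" by (simp add: sum_nonneg_eq_0_iff)
  with sep[OF z(1)] hz z(2) show False by blast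
qed

subsection \<open>The standard scalar products\<close>

text \<open>With a single index range, bilinearity and the values at unit vectors can be checked
  term by term.\<close>

lemma scalar_rs_signs:
  "scalar_rs r s x y = (\<Sum>i<r + s. (if i < r then 1 else - 1) * (x $ i * y $ i))"
proof -
  have "(\<Sum>i<r + s. (if i < r then 1 else - 1) * (x $ i * y $ i))
      = (\<Sum>i<r. (if i < r then 1 else - 1) * (x $ i * y $ i))
        + (\<Sum>j<s. (if r + j < r then 1 else - 1) * (x $ (r + j) * y $ (r + j)))"
    by (induction s) simp_all
  then show ?thesis by (simp add: scalar_rs_def sum_negf)
qed

lemma scalar_rs_commute: "scalar_rs r s x y = scalar_rs r s y x"
  by (simp add: scalar_rs_def mult.commute)

lemma functional_on_scalar_rs:
  shows "functional_on (r + s) (\<lambda>x. scalar_rs r s x y)" "functional_on (r + s) (scalar_rs r s y)"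
proof -
  have "scalar_rs r s (u + v) y = scalar_rs r s u y + scalar_rs r s v y"
    if "u \<in> carrier_vec (r + s)" "v \<in> carrier_vec (r + s)" for u v
    unfolding scalar_rs_signs sum.distrib[symmetric]
    by (rule sum.cong) (use that in \<open>auto simp: distrib_right\<close>)
  moreover have "scalar_rs r s (c \<cdot>\<^sub>v u) y = c * scalar_rs r s u y"
    if "u \<in> carrier_vec (r + s)" for c u
    unfolding scalar_rs_signs sum_distrib_left
    by (rule sum.cong) (use that in auto)
  ultimately show "functional_on (r + s) (\<lambda>x. scalar_rs r s x y)"
    unfolding linear_on_def by blast
  moreover have "scalar_rs r s y = (\<lambda>x. scalar_rs r s x y)"
    by (rule ext) (rule scalar_rs_commute)
  ultimately show "functional_on (r + s) (scalar_rs r s y)" by simp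
qed

lemma scalar_rs_unit:
  assumes "i < r + s" "y \<in> carrier_vec (r + s)"
  shows "scalar_rs r s (unit_vec (r + s) i) y = (if i < r then 1 else - 1) * y $ i"
proof -
  have "scalar_rs r s (unit_vec (r + s) i) y
      = (\<Sum>j<r + s. if j = i then (if i < r then 1 else - 1) * y $ i else 0)"
    unfolding scalar_rs_signs by (rule sum.cong) (use assms in auto)
  then show ?thesis using assms(1) by simp
qed

text \<open>Non-degeneracy of the form: pairing with unit vectors recovers the coordinates up to
  sign.\<close>

lemma scalar_rs_eqI:
  assumes "x \<in> carrier_vec (r + s)" "y \<in> carrier_vec (r + s)"
    and "\<And>z. z \<in> carrier_vec (r + s) \<Longrightarrow> scalar_rs r s z x = scalar_rs r s z y"
  shows "x = y"
proof (rule eq_vecI)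
  fix i assume "i < dim_vec y"
  then have i: "i < r + s" using assms(2) by simp
  show "x $ i = y $ i"
    using assms(3)[of "unit_vec (r + s) i"] scalar_rs_unit[OF i assms(1)] scalar_rs_unit[OF i assms(2)]
    by (auto split: if_splits)
qed (use assms in auto)

text \<open>Riesz representation for the indefinite form. It justifies the definite descriptions in
  \<open>h_bracket\<close> and in \<open>form_adjoint\<close> on coordinate spaces.\<close>

lemma scalar_rs_represents:
  assumes g: "functional_on (r + s) g"
  shows "\<exists>!w. w \<in> carrier_vec (r + s) \<and> (\<forall>z \<in> carrier_vec (r + s). g z = scalar_rs r s z w)"
proof (rule ex_ex1I)
  \<comment> \<open>Pairing with a unit vector returns the coordinate up to sign; the same sign
    compensates, since its square is 1.\<close>
  define w where
    "w = vec (r + s) (\<lambda>i. (if i < r then 1 else - 1) * g (unit_vec (r + s) i))"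
  have "g z = scalar_rs r s z w" if z: "z \<in> carrier_vec (r + s)" for z
    unfolding functional_on_expand[OF g z] scalar_rs_signs
    by (rule sum.cong) (auto simp: w_def)
  moreover have "w \<in> carrier_vec (r + s)" by (simp add: w_def)
  ultimately show "\<exists>w. w \<in> carrier_vec (r + s) \<and> (\<forall>z \<in> carrier_vec (r + s). g z = scalar_rs r s z w)"
    by blast
next
  fix w w'
  assume "w \<in> carrier_vec (r + s) \<and> (\<forall>z \<in> carrier_vec (r + s). g z = scalar_rs r s z w)"
    and "w' \<in> carrier_vec (r + s) \<and> (\<forall>z \<in> carrier_vec (r + s). g z = scalar_rs r s z w')"
  then show "w = w'" by (intro scalar_rs_eqI) auto
qed

text \<open>Sylvester's law for the form pulled back along \<open>T\<close>: four instances of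
  \<open>inertia_le\<close>, in which the coordinates of \<open>z\<close> are the separating
  functionals. For \<open>\<sigma> = - 1\<close> positive squares on one side are matched with
  negative squares on the other.\<close>

lemma signature_le:
  assumes T: "linear_on (carrier_vec (r' + s')) (\<cdot>\<^sub>v) (\<cdot>\<^sub>v) T"
      "\<And>z. z \<in> carrier_vec (r' + s') \<Longrightarrow> T z \<in> carrier_vec (r + s)"
    and eq: "\<And>z. z \<in> carrier_vec (r' + s') \<Longrightarrow>
      scalar_rs r s (T z) (T z) = \<sigma> * scalar_rs r' s' z z"
  shows "\<sigma> = 1 \<Longrightarrow> r' \<le> r \<and> s' \<le> s" "\<sigma> = - 1 \<Longrightarrow> r' \<le> s \<and> s' \<le> r"
proof -
  have Tf: "functional_on (r' + s') (\<lambda>z. T z $ i)" if "i < r + s" for i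
    using functional_on_compose_index[OF T(1)] T(2) that by blast
  have sep: "z = 0\<^sub>v (r' + s')"
    if "z \<in> carrier_vec (r' + s')" "\<forall>i<r'. z $ i = 0" "\<forall>i<s'. z $ (r' + i) = 0" for z :: "real vec"
  proof (rule eq_vecI)
    fix i assume "i < dim_vec (0\<^sub>v (r' + s') :: real vec)"
    then have "i < r' \<or> (\<exists>j<s'. i = r' + j)" by (auto intro: exI[of _ "i - r'"])
    then show "z $ i = 0\<^sub>v (r' + s') $ i" using that by auto
  qed (use that in auto)
  have eq': "(\<Sum>i<r. (T z $ i)\<^sup>2) - (\<Sum>i<s. (T z $ (r + i))\<^sup>2)
      = \<sigma> * ((\<Sum>i<r'. (z $ i)\<^sup>2) - (\<Sum>i<s'. (z $ (r' + i))\<^sup>2))"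
    if "z \<in> carrier_vec (r' + s')" for z
    using eq[OF that] by (simp add: scalar_rs_def power2_eq_square)
  \<comment> \<open>\<open>T1\<close> and \<open>T2\<close> cover the positive and the negative
    coordinates of \<open>T z\<close>; \<open>I1\<close> and \<open>I2\<close> cover those of
    \<open>z\<close>.\<close>
  note T1 = Tf[OF trans_less_add1] and T2 = Tf[OF add_strict_left_mono]
    and I1 = functional_on_index[OF trans_less_add1] and I2 = functional_on_index[OF add_strict_left_mono]
  show "r' \<le> r \<and> s' \<le> s" if "\<sigma> = 1"
  proof
    show "r' \<le> r"
      by (rule inertia_le[OF refl T1 I2 _ sep, where h = "\<lambda>i z. T z $ (r + i)" and q = s])
        (use eq' that in simp_all)
    \<comment> \<open>The identity is negated, so that the negative squares take the role of the
      positive ones; the dimension then has to be read as \<open>s' + r'\<close>.\<close>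
    show "s' \<le> s"
    proof (rule inertia_le[OF add.commute T2 I1 _ sep, where h = "\<lambda>i z. T z $ i" and q = r])
      fix z :: "real vec" assume "z \<in> carrier_vec (r' + s')"
      from eq'[OF this] that show "(\<Sum>i<s. (T z $ (r + i))\<^sup>2) - (\<Sum>i<r. (T z $ i)\<^sup>2)
          = (\<Sum>i<s'. (z $ (r' + i))\<^sup>2) - (\<Sum>i<r'. (z $ i)\<^sup>2)" by simp
    qed
  qed
  show "r' \<le> s \<and> s' \<le> r" if "\<sigma> = - 1"
  proof
    show "r' \<le> s"
    proof (rule inertia_le[OF refl T2 I2 _ sep, where h = "\<lambda>i z. T z $ i" and q = r])
      fix z :: "real vec" assume "z \<in> carrier_vec (r' + s')"
      from eq'[OF this] that show "(\<Sum>i<s. (T z $ (r + i))\<^sup>2) - (\<Sum>i<r. (T z $ i)\<^sup>2)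
          = (\<Sum>i<r'. (z $ i)\<^sup>2) - (\<Sum>i<s'. (z $ (r' + i))\<^sup>2)" by simp
    qed
    show "s' \<le> r"
    proof (rule inertia_le[OF add.commute T1 I1 _ sep, where h = "\<lambda>i z. T z $ (r + i)" and q = s])
      fix z :: "real vec" assume "z \<in> carrier_vec (r' + s')"
      from eq'[OF this] that show "(\<Sum>i<r. (T z $ i)\<^sup>2) - (\<Sum>i<s. (T z $ (r + i))\<^sup>2)
          = (\<Sum>i<s'. (z $ (r' + i))\<^sup>2) - (\<Sum>i<r'. (z $ i)\<^sup>2)" by simp
    qed
  qed
qed

section \<open>Quadratic forms with equal absolute values\<close>

lemma quadratic_product_zero:
  fixes p0 p1 p2 q0 q1 q2 :: real
  assumes "\<And>t. (p0 + t * p1 + t\<^sup>2 * p2) * (q0 + t * q1 + t\<^sup>2 * q2) = 0"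
  shows "p0 = 0 \<or> q2 = 0"
proof -
  \<comment> \<open>A real polynomial vanishing everywhere is zero, and polynomials over the reals
    have no zero divisors, so one factor has only zero coefficients.\<close>
  have "poly ([:p0, p1, p2:] * [:q0, q1, q2:]) t = 0" for t
    using assms[of t] by (simp add: power2_eq_square algebra_simps)
  then have "[:p0, p1, p2:] * [:q0, q1, q2:] = 0" using poly_all_0_iff_0 by blast
  then show ?thesis by auto
qed

text \<open>Pointwise the sign could depend on \<open>x\<close>. Along the line
  \<open>x + t \<cdot>\<^sub>v y\<close> the difference and the sum of the two forms are quadratic
  polynomials in \<open>t\<close> with zero product, so the difference vanishes at \<open>x\<close>
  or the sum vanishes at \<open>y\<close>. As \<open>x\<close> and \<open>y\<close> are independent,
  one sign serves for all vectors.\<close>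

lemma forms_equal_up_to_sign:
  fixes \<beta> \<gamma> :: "real vec \<Rightarrow> real vec \<Rightarrow> real"
  assumes \<beta>: "\<And>y. y \<in> carrier_vec n \<Longrightarrow> functional_on n (\<lambda>x. \<beta> x y)"
    and \<gamma>: "\<And>y. y \<in> carrier_vec n \<Longrightarrow> functional_on n (\<lambda>x. \<gamma> x y)"
    and sym: "\<And>x y. \<beta> x y = \<beta> y x" "\<And>x y. \<gamma> x y = \<gamma> y x"
    and abs_eq: "\<And>x. x \<in> carrier_vec n \<Longrightarrow> \<bar>\<beta> x x\<bar> = \<bar>\<gamma> x x\<bar>"
  shows "\<exists>\<sigma>. (\<sigma> = 1 \<or> \<sigma> = - 1) \<and> (\<forall>x \<in> carrier_vec n. \<forall>y \<in> carrier_vec n. \<beta> x y = \<sigma> * \<gamma> x y)"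
proof -
  have expand: "\<delta> (x + t \<cdot>\<^sub>v y) (x + t \<cdot>\<^sub>v y) = \<delta> x x + t * (2 * \<delta> x y) + t\<^sup>2 * \<delta> y y"
    if xn: "x \<in> carrier_vec n" and yn: "y \<in> carrier_vec n"
      and fn: "\<And>y. y \<in> carrier_vec n \<Longrightarrow> functional_on n (\<lambda>x. \<delta> x y)" and sm: "\<And>x y. \<delta> x y = \<delta> y x"
    for \<delta> :: "real vec \<Rightarrow> real vec \<Rightarrow> real" and x y t
  proof -
    have *: "\<delta> (x + t \<cdot>\<^sub>v y) w = \<delta> x w + t * \<delta> y w" if w: "w \<in> carrier_vec n" for w :: "real vec"
      using linear_on_add[OF fn[OF w] xn, of "t \<cdot>\<^sub>v y"]
        linear_on_scale[OF fn[OF w] yn, of t] yn by simp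
    have "\<delta> (x + t \<cdot>\<^sub>v y) (x + t \<cdot>\<^sub>v y) = \<delta> x (x + t \<cdot>\<^sub>v y) + t * \<delta> y (x + t \<cdot>\<^sub>v y)"
      using xn yn by (intro *) simp
    also have "\<dots> = \<delta> (x + t \<cdot>\<^sub>v y) x + t * \<delta> (x + t \<cdot>\<^sub>v y) y"
      using sm by metis
    also have "\<dots> = \<delta> x x + t * (2 * \<delta> x y) + t\<^sup>2 * \<delta> y y"
      using *[OF xn] *[OF yn] sm[of y x]
      by (simp add: algebra_simps power2_eq_square)
    finally show ?thesis .
  qed
  have prod: "\<beta> x x - \<gamma> x x = 0 \<or> \<beta> y y + \<gamma> y y = 0"
    if x: "x \<in> carrier_vec n" and y: "y \<in> carrier_vec n" for x y
  proof (rule quadratic_product_zero)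
    fix t
    let ?v = "x + t \<cdot>\<^sub>v y"
    have "(\<beta> ?v ?v - \<gamma> ?v ?v) * (\<beta> ?v ?v + \<gamma> ?v ?v) = 0"
      using abs_eq[of ?v] x y by (auto simp: abs_eq_iff)
    then have "(\<beta> x x + t * (2 * \<beta> x y) + t\<^sup>2 * \<beta> y y - (\<gamma> x x + t * (2 * \<gamma> x y) + t\<^sup>2 * \<gamma> y y)) *
        (\<beta> x x + t * (2 * \<beta> x y) + t\<^sup>2 * \<beta> y y + (\<gamma> x x + t * (2 * \<gamma> x y) + t\<^sup>2 * \<gamma> y y)) = 0"
      by (simp only: expand[OF x y \<beta> sym(1)] expand[OF x y \<gamma> sym(2)])
    moreover have "\<beta> x x + t * (2 * \<beta> x y) + t\<^sup>2 * \<beta> y y - (\<gamma> x x + t * (2 * \<gamma> x y) + t\<^sup>2 * \<gamma> y y)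
        = \<beta> x x - \<gamma> x x + t * (2 * \<beta> x y - 2 * \<gamma> x y) + t\<^sup>2 * (\<beta> y y - \<gamma> y y)"
      by (simp add: algebra_simps)
    moreover have "\<beta> x x + t * (2 * \<beta> x y) + t\<^sup>2 * \<beta> y y + (\<gamma> x x + t * (2 * \<gamma> x y) + t\<^sup>2 * \<gamma> y y)
        = \<beta> x x + \<gamma> x x + t * (2 * \<beta> x y + 2 * \<gamma> x y) + t\<^sup>2 * (\<beta> y y + \<gamma> y y)"
      by (simp add: algebra_simps)
    ultimately show "(\<beta> x x - \<gamma> x x + t * (2 * \<beta> x y - 2 * \<gamma> x y) + t\<^sup>2 * (\<beta> y y - \<gamma> y y)) *
        (\<beta> x x + \<gamma> x x + t * (2 * \<beta> x y + 2 * \<gamma> x y) + t\<^sup>2 * (\<beta> y y + \<gamma> y y)) = 0"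
      by simp
  qed
  \<comment> \<open>Polarisation: the expansion at \<open>t = 1\<close>, after cancelling the
    diagonal terms.\<close>
  have polar: "\<beta> x y = \<sigma> * \<gamma> x y"
    if x: "x \<in> carrier_vec n" and y: "y \<in> carrier_vec n"
      and q: "\<And>x. x \<in> carrier_vec n \<Longrightarrow> \<beta> x x = \<sigma> * \<gamma> x x" for \<sigma> x y
  proof -
    have "\<beta> (x + 1 \<cdot>\<^sub>v y) (x + 1 \<cdot>\<^sub>v y) = \<sigma> * \<gamma> (x + 1 \<cdot>\<^sub>v y) (x + 1 \<cdot>\<^sub>v y)"
      by (rule q) (use x y in simp)
    then have "\<beta> x x + 1 * (2 * \<beta> x y) + 1\<^sup>2 * \<beta> y y = \<sigma> * (\<gamma> x x + 1 * (2 * \<gamma> x y) + 1\<^sup>2 * \<gamma> y y)"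
      by (simp only: expand[OF x y \<beta> sym(1)] expand[OF x y \<gamma> sym(2)])
    then show ?thesis unfolding q[OF x] q[OF y] by (simp add: distrib_left)
  qed
  show ?thesis
  proof (cases "\<forall>x \<in> carrier_vec n. \<beta> x x - \<gamma> x x = 0")
    case True
    then show ?thesis using polar[of _ _ 1] by (intro exI[of _ 1]) auto
  next
    case False
    \<comment> \<open>A single vector at which the difference is nonzero forces the sum to vanish at
      every \<open>y\<close>.\<close>
    then have "\<forall>y \<in> carrier_vec n. \<beta> y y + \<gamma> y y = 0" using prod by blast
    then show ?thesis using polar[of _ _ "- 1"] by (intro exI[of _ "- 1"]) force
  qed
qed

subsection \<open>Determinants of endomorphisms\<close>

lemma finite_dimensional_vector_space_of_basis:
  fixes B :: "'u::real_vector set"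
  assumes "finite B" "independent B" "span B = UNIV"
  shows "finite_dimensional_vector_space (scaleR :: real \<Rightarrow> 'u \<Rightarrow> 'u) B"
  by unfold_locales
    (use assms in \<open>simp_all add: dependent_raw_def span_raw_def\<close>)

lemma some_basis:
  assumes "finite_dimensional TYPE('u::real_vector)"
  defines "bs \<equiv> some_basis TYPE('u)"
  shows "distinct bs" "independent (set bs)" "span (set bs) = UNIV"
proof -
  obtain B0 :: "'u set" where B0: "finite B0" "span B0 = UNIV"
    using assms(1) unfolding finite_dimensional_def by blast
  obtain B where B: "B \<subseteq> B0" "independent B" "B0 \<subseteq> span B"
    using maximal_independent_subset[of B0] by blast
  have "finite B" using B(1) B0(1) finite_subset by blast
  then obtain xs where xs: "set xs = B" "distinct xs"
    using finite_distinct_list by blast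
  have "span B = UNIV"
    using B(3) B0(2) span_mono[of B0 "span B"] by (auto simp: span_span)
  then have "\<exists>bs :: 'u list. distinct bs \<and> independent (set bs) \<and> span (set bs) = UNIV"
    using xs B(2) by blast
  from someI_ex[OF this] show "distinct bs" "independent (set bs)" "span (set bs) = UNIV"
    unfolding bs_def some_basis_def by blast+
qed

text \<open>All matrices are taken in the same basis \<open>some_basis\<close>, so the matrix of the
  composition is the product of the matrices.\<close>

lemma endo_det_compose:
  fixes f g :: "'u::real_vector \<Rightarrow> 'u"
  assumes fd: "finite_dimensional TYPE('u)" and f: "linear f" and g: "linear g"
  shows "endo_det (f \<circ> g) = endo_det f * endo_det g"
proof -
  define bs :: "'u list" where "bs = some_basis TYPE('u)"
  note bs = some_basis[OF fd, folded bs_def]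
  let ?n = "length bs"
  let ?rep = "representation (set bs)"
  let ?mat = "\<lambda>f. mat ?n ?n (\<lambda>(i, j). ?rep (f (bs ! j)) (bs ! i))"
  have expand: "v = (\<Sum>k<?n. ?rep v (bs ! k) *\<^sub>R bs ! k)" for v
  proof -
    have "v = (\<Sum>b \<in> set bs. ?rep v b *\<^sub>R b)"
      using sum_representation_eq[OF bs(2) _ _ subset_refl, of v] bs(3) by simp
    also have "\<dots> = (\<Sum>k<?n. ?rep v (bs ! k) *\<^sub>R bs ! k)"
      by (rule sum.reindex_bij_betw[symmetric]) (rule bij_betw_nth[OF bs(1)], auto)
    finally show ?thesis .
  qed
  have "?rep (f (g v)) b = (\<Sum>k<?n. ?rep (f (bs ! k)) b * ?rep (g v) (bs ! k))" for v b
  proof -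
    have "f (g v) = f (\<Sum>k<?n. ?rep (g v) (bs ! k) *\<^sub>R bs ! k)"
      using expand[of "g v"] by simp
    also have "\<dots> = (\<Sum>k<?n. ?rep (g v) (bs ! k) *\<^sub>R f (bs ! k))"
      by (simp add: linear_sum[OF f] linear_scale[OF f])
    also have "?rep \<dots> b = (\<Sum>k<?n. ?rep (f (bs ! k)) b * ?rep (g v) (bs ! k))"
      using bs(3) by (simp add: representation_sum[OF bs(2)] representation_scale[OF bs(2)] mult.commute)
    finally show ?thesis .
  qed
  then have "?mat (f \<circ> g) = ?mat f * ?mat g"
    by (intro eq_matI) (auto simp: scalar_prod_def lessThan_atLeast0)
  then have "det (?mat (f \<circ> g)) = det (?mat f) * det (?mat g)"
    by (simp add: det_mult[of _ ?n])
  then show ?thesis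
    by (simp add: endo_det_def Let_def bs_def)
qed

lemma endo_det_scaleR:
  assumes fd: "finite_dimensional TYPE('u::real_vector)"
  shows "endo_det (\<lambda>x :: 'u. c *\<^sub>R x) = c ^ dim (UNIV :: 'u set)"
proof -
  define bs :: "'u list" where "bs = some_basis TYPE('u)"
  note bs = some_basis[OF fd, folded bs_def]
  let ?n = "length bs"
  have "mat ?n ?n (\<lambda>(i, j). representation (set bs) (c *\<^sub>R bs ! j) (bs ! i)) = c \<cdot>\<^sub>m 1\<^sub>m ?n"
    using bs nth_eq_iff_index_eq[OF bs(1)]
    by (intro eq_matI)
      (auto simp: representation_scale[OF bs(2)] representation_basis[OF bs(2)])
  then have "endo_det (\<lambda>x :: 'u. c *\<^sub>R x) = c ^ ?n"
    by (simp add: endo_det_def Let_def flip: bs_def)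
  also have "?n = dim (UNIV :: 'u set)"
    using dim_eq_card_independent[OF bs(2)] dim_span[of "set bs"] bs(3) distinct_card[OF bs(1)] by simp
  finally show ?thesis .
qed

lemma endo_det_nonzero:
  fixes f :: "'u::real_vector \<Rightarrow> 'u"
  assumes fd: "finite_dimensional TYPE('u)" and f: "linear f" "inj f"
  shows "endo_det f \<noteq> 0"
proof -
  obtain g where g: "linear g" "g \<circ> f = id"
    using linear_injective_left_inverse[OF f] by blast
  \<comment> \<open>The identity is written as scaling by 1, so that \<open>endo_det_scaleR\<close>
    evaluates its determinant.\<close>
  have "endo_det g * endo_det f = endo_det (\<lambda>x :: 'u. 1 *\<^sub>R x)"
    using endo_det_compose[OF fd g(1) f(1)] g(2) by (simp add: id_def)
  also have "\<dots> = 1" by (simp only: endo_det_scaleR[OF fd] power_one)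
  finally show ?thesis by auto
qed

text \<open>Positivity of the dimension allows cancelling the exponent in
  \<open>abs_scalar_eq\<close> and taking the root that normalises \<open>A\<close>.\<close>

lemma dim_UNIV_pos:
  assumes fd: "finite_dimensional TYPE('u::real_vector)" and "\<exists>x :: 'u. x \<noteq> 0"
  shows "dim (UNIV :: 'u set) > 0"
proof -
  define bs :: "'u list" where "bs = some_basis TYPE('u)"
  note bs = some_basis[OF fd, folded bs_def]
  have "dim (UNIV :: 'u set) = card (set bs)"
    using dim_eq_card_independent[OF bs(2)] dim_span[of "set bs"] bs(3) by simp
  moreover have "bs \<noteq> []" using bs(3) assms(2) by (auto simp: set_eq_iff)
  ultimately show ?thesis by (simp add: card_gt_0_iff)
qed

subsection \<open>Adjoints\<close>

text \<open>Riesz representation. By non-degeneracy \<open>u\<close> is determined by the functional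
  \<open>\<lambda>x. b x u\<close>. The map \<open>T\<close> records the values of this functional
  on a basis as a vector of the same space, so it is an injective endomorphism, hence surjective by
  finite dimension.\<close>

lemma scalar_product_represents:
  fixes b :: "'u::real_vector \<Rightarrow> 'u \<Rightarrow> real"
  assumes fd: "finite_dimensional TYPE('u)" and b: "scalar_product b" and g: "linear g"
  shows "\<exists>!u. \<forall>x. g x = b x u"
proof (rule ex_ex1I)
  define bs :: "'u list" where "bs = some_basis TYPE('u)"
  note bs = some_basis[OF fd, folded bs_def]
  interpret fd: finite_dimensional_vector_space "scaleR :: real \<Rightarrow> 'u \<Rightarrow> 'u" "set bs"
    by (rule finite_dimensional_vector_space_of_basis) (use bs in auto)
  have lin: "linear (b x)" "linear (\<lambda>x. b x y)" for x y
    using b by (auto simp: scalar_product_def)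
  define T where "T u = (\<Sum>e \<in> set bs. b e u *\<^sub>R e)" for u
  have T: "linear T"
    unfolding T_def
    by (rule linearI)
      (simp_all add: linear_add[OF lin(1)] linear_scale[OF lin(1)] scaleR_add_left sum.distrib scaleR_sum_right)
  have coeff: "f e = h e" if "(\<Sum>e \<in> set bs. f e *\<^sub>R e) = (\<Sum>e \<in> set bs. h e *\<^sub>R e)" "e \<in> set bs" for f h e
    using that independentD[OF bs(2) finite_set subset_refl, of "\<lambda>e. f e - h e" e]
    by (simp add: scaleR_diff_left sum_subtractf)
  have ext: "g1 = g2" if "linear g1" "linear g2" "\<And>e. e \<in> set bs \<Longrightarrow> g1 e = g2 e"
    for g1 g2 :: "'u \<Rightarrow> real"
    by (rule ext) (rule linear_eq_on_span[OF that(1,2) that(3)], use bs in auto)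
  have "inj T"
    unfolding linear_injective_0[OF T]
  proof (intro allI impI)
    fix u assume "T u = 0"
    then have "b e u = 0" if "e \<in> set bs" for e
      using coeff[of "\<lambda>e. b e u" "\<lambda>_. 0" e] that by (simp add: T_def)
    then have "(\<lambda>x. b x u) = (\<lambda>x. 0)"
      by (intro ext lin) (auto simp: linear_iff)
    then have "b u y = 0" for y
      using b by (metis scalar_product_def)
    then show "u = 0" using b by (simp add: scalar_product_def)
  qed
  then have "surj T" by (rule fd.linear_inj_imp_surj[OF T[unfolded linear_def]])
  then obtain u where u: "T u = (\<Sum>e \<in> set bs. g e *\<^sub>R e)" by (metis surjD)
  have "g = (\<lambda>x. b x u)"
    using coeff[OF u[unfolded T_def]] by (intro ext g lin) simp
  then show "\<exists>u. \<forall>x. g x = b x u" by metis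
next
  fix u u' assume "\<forall>x. g x = b x u" "\<forall>x. g x = b x u'"
  then have eq: "b x u = b x u'" for x by metis
  have lin: "linear (b x)" for x using b by (auto simp: scalar_product_def)
  have "b (u - u') y = 0" for y
    using eq[of y] linear_diff[OF lin, of y u u'] b by (simp add: scalar_product_def)
  then have "u - u' = 0" using b unfolding scalar_product_def by blast
  then show "u = u'" by simp
qed

lemma form_adjoint_UNIV:
  fixes b :: "'u::real_vector \<Rightarrow> 'u \<Rightarrow> real" and b' :: "'v::real_vector \<Rightarrow> 'v \<Rightarrow> real"
  assumes fd: "finite_dimensional TYPE('u)" and b: "scalar_product b" and b': "scalar_product b'"
    and A: "linear A"
  shows "b' (A x) y = b x (form_adjoint UNIV b b' A y)"
    and "(\<And>x. b' (A x) y = b x u) \<Longrightarrow> form_adjoint UNIV b b' A y = u"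
proof -
  have "linear (\<lambda>x. b' (A x) y)"
    using linear_compose[OF A, of "\<lambda>v. b' v y"] b' by (simp add: scalar_product_def comp_def)
  note ex = scalar_product_represents[OF fd b this]
  have eq: "form_adjoint UNIV b b' A y = (THE u. \<forall>x. b' (A x) y = b x u)"
    by (simp add: form_adjoint_def)
  show "b' (A x) y = b x (form_adjoint UNIV b b' A y)"
    unfolding eq using theI'[OF ex] by blast
  show "(\<And>x. b' (A x) y = b x u) \<Longrightarrow> form_adjoint UNIV b b' A y = u"
    unfolding eq using the1_equality[OF ex, of u] by blast
qed

lemma linear_form_adjoint_UNIV:
  fixes b :: "'u::real_vector \<Rightarrow> 'u \<Rightarrow> real" and b' :: "'v::real_vector \<Rightarrow> 'v \<Rightarrow> real"
  assumes fd: "finite_dimensional TYPE('u)" and b: "scalar_product b" and b': "scalar_product b'"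
    and A: "linear A"
  shows "linear (form_adjoint UNIV b b' A)"
proof -
  note adj = form_adjoint_UNIV[OF assms]
  have l: "linear (b x)" "linear (b' y)" for x y using b b' by (auto simp: scalar_product_def)
  show ?thesis
    by (rule linearI; rule adj(2))
      (simp_all add: linear_add[OF l(1)] linear_add[OF l(2)] linear_scale[OF l(1)] linear_scale[OF l(2)]
        adj(1)[symmetric])
qed

text \<open>A vector in the kernel of the adjoint is orthogonal to the range of \<open>A\<close>,
  which is the whole space.\<close>

lemma inj_form_adjoint_UNIV:
  fixes b :: "'u::real_vector \<Rightarrow> 'u \<Rightarrow> real" and b' :: "'v::real_vector \<Rightarrow> 'v \<Rightarrow> real"
  assumes fd: "finite_dimensional TYPE('u)" and b: "scalar_product b" and b': "scalar_product b'"
    and A: "linear A" "surj A"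
  shows "inj (form_adjoint UNIV b b' A)"
  unfolding linear_injective_0[OF linear_form_adjoint_UNIV[OF fd b b' A(1)]]
proof (intro allI impI)
  fix y assume "form_adjoint UNIV b b' A y = 0"
  moreover have "linear (b x)" for x using b by (auto simp: scalar_product_def)
  ultimately have "b' (A x) y = 0" for x
    using form_adjoint_UNIV(1)[OF fd b b' A(1), of x y] by (simp add: linear_0)
  then have "b' v y = 0" for v using A(2) by (metis surjD)
  then show "y = 0" using b' unfolding scalar_product_def by metis
qed

lemma form_adjoint_rs:
  assumes C: "linear_on (carrier_vec (r + s)) (\<cdot>\<^sub>v) (\<cdot>\<^sub>v) C"
      "\<And>z. z \<in> carrier_vec (r + s) \<Longrightarrow> C z \<in> carrier_vec (r' + s')"
  defines "Ct \<equiv> form_adjoint (carrier_vec (r + s)) (scalar_rs r s) (scalar_rs r' s') C"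
  assumes y: "y \<in> carrier_vec (r' + s')"
  shows "Ct y \<in> carrier_vec (r + s)"
    and "x \<in> carrier_vec (r + s) \<Longrightarrow> scalar_rs r' s' (C x) y = scalar_rs r s x (Ct y)"
    and "u \<in> carrier_vec (r + s) \<Longrightarrow>
      (\<And>x. x \<in> carrier_vec (r + s) \<Longrightarrow> scalar_rs r' s' (C x) y = scalar_rs r s x u) \<Longrightarrow> Ct y = u"
proof -
  have "functional_on (r + s) (\<lambda>x. scalar_rs r' s' (C x) y)"
    using C functional_on_scalar_rs(1)[of r' s' y] by (simp add: linear_on_def)
  note ex = scalar_rs_represents[OF this]
  show "Ct y \<in> carrier_vec (r + s)"
    and "x \<in> carrier_vec (r + s) \<Longrightarrow> scalar_rs r' s' (C x) y = scalar_rs r s x (Ct y)"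
    unfolding Ct_def form_adjoint_def using theI'[OF ex] by blast+
  show "u \<in> carrier_vec (r + s) \<Longrightarrow>
      (\<And>x. x \<in> carrier_vec (r + s) \<Longrightarrow> scalar_rs r' s' (C x) y = scalar_rs r s x u) \<Longrightarrow> Ct y = u"
    unfolding Ct_def form_adjoint_def using the1_equality[OF ex, of u] by blast
qed

lemma linear_on_form_adjoint_rs:
  assumes C: "linear_on (carrier_vec (r + s)) (\<cdot>\<^sub>v) (\<cdot>\<^sub>v) C"
      "\<And>z. z \<in> carrier_vec (r + s) \<Longrightarrow> C z \<in> carrier_vec (r' + s')"
  shows "linear_on (carrier_vec (r' + s')) (\<cdot>\<^sub>v) (\<cdot>\<^sub>v)
    (form_adjoint (carrier_vec (r + s)) (scalar_rs r s) (scalar_rs r' s') C)"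
proof -
  note adj = form_adjoint_rs[OF C]
  note lin = functional_on_scalar_rs(2)
  show ?thesis
    unfolding linear_on_def
    by (intro conjI ballI allI; rule adj(3))
      (simp_all add: adj(1) adj(2)[symmetric] linear_on_add[OF lin] linear_on_scale[OF lin])
qed

subsection \<open>Pseudo H-type algebras\<close>

lemma admissible_moduleD:
  fixes b :: "'u::real_vector \<Rightarrow> 'u \<Rightarrow> real"
  assumes "admissible_module r s b J"
  shows "finite_dimensional TYPE('u)" "scalar_product b"
    and "z \<in> carrier_vec (r + s) \<Longrightarrow> linear (J z)"
    and "linear_on (carrier_vec (r + s)) (\<cdot>\<^sub>v) (*\<^sub>R) (\<lambda>z. J z x)"
    and "z \<in> carrier_vec (r + s) \<Longrightarrow> J z (J z x) = - scalar_rs r s z z *\<^sub>R x"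
  using assms by (auto simp: admissible_module_def clifford_module_def)

lemma h_bracket:
  assumes adm: "admissible_module r s b J"
  shows "h_bracket r s b J x y \<in> carrier_vec (r + s)"
    and "z \<in> carrier_vec (r + s) \<Longrightarrow> b (J z x) y = scalar_rs r s z (h_bracket r s b J x y)"
    and "w \<in> carrier_vec (r + s) \<Longrightarrow>
      (\<And>z. z \<in> carrier_vec (r + s) \<Longrightarrow> b (J z x) y = scalar_rs r s z w) \<Longrightarrow> h_bracket r s b J x y = w"
proof -
  have lin: "linear (\<lambda>u. b u y)"
    using admissible_moduleD(2)[OF adm] by (simp add: scalar_product_def)
  have "functional_on (r + s) (\<lambda>z. b (J z x) y)"
    using admissible_moduleD(4)[OF adm, of x] linear_add[OF lin] linear_scale[OF lin]
    by (simp add: linear_on_def)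
  note ex = scalar_rs_represents[OF this]
  show "h_bracket r s b J x y \<in> carrier_vec (r + s)"
    and "z \<in> carrier_vec (r + s) \<Longrightarrow> b (J z x) y = scalar_rs r s z (h_bracket r s b J x y)"
    unfolding h_bracket_def using theI'[OF ex] by blast+
  show "w \<in> carrier_vec (r + s) \<Longrightarrow>
      (\<And>z. z \<in> carrier_vec (r + s) \<Longrightarrow> b (J z x) y = scalar_rs r s z w) \<Longrightarrow> h_bracket r s b J x y = w"
    unfolding h_bracket_def using the1_equality[OF ex, of w] by blast
qed

lemma scalar_rs_0_right: "scalar_rs r s z (0\<^sub>v (r + s)) = 0"
  by (simp add: scalar_rs_signs)

lemma h_bracket_0_left:
  assumes adm: "admissible_module r s b J"
  shows "h_bracket r s b J 0 y = 0\<^sub>v (r + s)"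
proof (rule h_bracket(3)[OF adm])
  fix z :: "real vec" assume z: "z \<in> carrier_vec (r + s)"
  have "linear (\<lambda>u. b u y)"
    using admissible_moduleD(2)[OF adm] by (simp add: scalar_product_def)
  then show "b (J z 0) y = scalar_rs r s z (0\<^sub>v (r + s))"
    using linear_0[OF admissible_moduleD(3)[OF adm z]] linear_0
    by (simp add: scalar_rs_0_right)
qed simp

text \<open>The elements of \<open>U\<close> that commute with everything are zero: pairing the
  bracket with a unit vector \<open>e\<close> gives \<open>J e x = 0\<close>, and \<open>J e\<close>
  is invertible because its square is plus or minus the identity. Such an \<open>e\<close> exists as
  \<open>r + s > 0\<close>.\<close>

lemma h_bracket_nondegenerate:
  assumes adm: "admissible_module r s b J" and pos: "r + s > 0"
    and zero: "\<And>y. h_bracket r s b J x y = 0\<^sub>v (r + s)"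
  shows "x = 0"
proof -
  let ?e = "unit_vec (r + s) 0 :: real vec"
  have e: "?e \<in> carrier_vec (r + s)" by simp
  have "b (J ?e x) y = 0" for y
    using h_bracket(2)[OF adm e, of x y] zero[of y] by (simp add: scalar_rs_0_right)
  then have "J ?e x = 0"
    using admissible_moduleD(2)[OF adm] by (simp add: scalar_product_def)
  then have "scalar_rs r s ?e ?e *\<^sub>R x = 0"
    using admissible_moduleD(5)[OF adm e, of x] linear_0[OF admissible_moduleD(3)[OF adm e]]
    by simp
  moreover have "scalar_rs r s ?e ?e \<noteq> 0"
    using scalar_rs_unit[OF pos e] pos by simp
  ultimately show "x = 0" by simp
qed

section \<open>Isomorphisms built from a pair of diagonal blocks\<close>

lemma linear_on_UNIV_0:
  fixes B :: "'u::real_vector \<Rightarrow> real vec"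
  assumes B: "linear_on UNIV (*\<^sub>R) (\<cdot>\<^sub>v) B" "range B \<subseteq> carrier_vec n"
  shows "B 0 = 0\<^sub>v n"
proof -
  have "B 0 \<in> carrier_vec n" using B(2) by blast
  moreover have "B 0 = 0 \<cdot>\<^sub>v B 0" using linear_on_scale[OF B(1), of 0 0] by simp
  moreover have "0 \<cdot>\<^sub>v v = 0\<^sub>v n" if "v \<in> carrier_vec n" for v :: "real vec"
    using that by auto
  ultimately show ?thesis by metis
qed

lemma vec_add_left_cancel:
  fixes u v w :: "real vec"
  assumes "u \<in> carrier_vec n" "v \<in> carrier_vec n" "w \<in> carrier_vec n" "w + u = w + v"
  shows "u = v"
proof (rule eq_vecI)
  fix i assume "i < dim_vec v"
  then show "u $ i = v $ i"
    using arg_cong[OF assms(4), of "\<lambda>x. x $ i"] assms(1-3) by simp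
qed (use assms in auto)

text \<open>The diagonal blocks \<open>A\<close> and \<open>C\<close> of an isomorphism, detached
  from the off-diagonal block. The locale is used twice: for the blocks of \<open>\<Phi>\<close> and
  for their rescaled versions.\<close>

locale graded_iso =
  fixes r s r' s' :: nat
    and bU :: "'u::real_vector \<Rightarrow> 'u \<Rightarrow> real" and bV :: "'v::real_vector \<Rightarrow> 'v \<Rightarrow> real"
    and J :: "real vec \<Rightarrow> 'u \<Rightarrow> 'u" and J' :: "real vec \<Rightarrow> 'v \<Rightarrow> 'v"
    and A :: "'u \<Rightarrow> 'v" and C :: "real vec \<Rightarrow> real vec"
  assumes U: "admissible_module r s bU J" and V: "admissible_module r' s' bV J'"
    and A: "linear A" "bij A"
    and C: "linear_on (carrier_vec (r + s)) (\<cdot>\<^sub>v) (\<cdot>\<^sub>v) C"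
    and bij_C: "bij_betw C (carrier_vec (r + s)) (carrier_vec (r' + s'))"
    and bracket: "C (h_bracket r s bU J x y) = h_bracket r' s' bV J' (A x) (A y)"
begin

abbreviation At :: "'v \<Rightarrow> 'u" where "At \<equiv> form_adjoint UNIV bU bV A"

abbreviation Ct :: "real vec \<Rightarrow> real vec" where
  "Ct \<equiv> form_adjoint (carrier_vec (r + s)) (scalar_rs r s) (scalar_rs r' s') C"

lemma C_carrier: "z \<in> carrier_vec (r + s) \<Longrightarrow> C z \<in> carrier_vec (r' + s')"
  using bij_C by (auto simp: bij_betw_def)

lemmas At = form_adjoint_UNIV[OF admissible_moduleD(1,2)[OF U] admissible_moduleD(2)[OF V] A(1)]

lemmas linear_At =
  linear_form_adjoint_UNIV[OF admissible_moduleD(1,2)[OF U] admissible_moduleD(2)[OF V] A(1)]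

lemmas Ct = form_adjoint_rs[OF C C_carrier]

text \<open>\<open>B\<close> is free because brackets ignore central components and have first
  component 0, where \<open>B\<close> vanishes.\<close>

lemma lie_algebra_iso_block_map:
  assumes B: "linear_on UNIV (*\<^sub>R) (\<cdot>\<^sub>v) B" "range B \<subseteq> carrier_vec (r' + s')"
  shows "lie_algebra_iso (pseudo_H_type r s bU J) (pseudo_H_type r' s' bV J') (block_map A B C)"
proof -
  have Bc: "B x \<in> carrier_vec (r' + s')" for x using B(2) by blast
  have "inj_on (block_map A B C) (UNIV \<times> carrier_vec (r + s))"
  proof (rule inj_onI)
    fix p q assume p: "p \<in> UNIV \<times> carrier_vec (r + s)" and q: "q \<in> UNIV \<times> carrier_vec (r + s)"
      and eq: "block_map A B C p = block_map A B C q"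
    obtain x z y w where xz: "p = (x, z)" "q = (y, w)" by fastforce
    have z: "z \<in> carrier_vec (r + s)" and w: "w \<in> carrier_vec (r + s)" using p q xz by auto
    have "A x = A y" and BC: "B x + C z = B y + C w" using eq xz by (auto simp: block_map_def)
    then have "x = y" using A(2) by (simp add: bij_def inj_eq)
    moreover from this have "C z = C w"
      using vec_add_left_cancel[OF C_carrier[OF z] C_carrier[OF w] Bc[of x]] BC by simp
    then have "z = w" using bij_C z w by (meson bij_betw_def inj_onD)
    ultimately show "p = q" using xz by simp
  qed
  moreover have "block_map A B C ` (UNIV \<times> carrier_vec (r + s)) = UNIV \<times> carrier_vec (r' + s')"
  proof
    show "block_map A B C ` (UNIV \<times> carrier_vec (r + s)) \<subseteq> UNIV \<times> carrier_vec (r' + s')"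
      using Bc C_carrier by (auto simp: block_map_def)
    show "UNIV \<times> carrier_vec (r' + s') \<subseteq> block_map A B C ` (UNIV \<times> carrier_vec (r + s))"
    proof
      fix p :: "'v \<times> real vec" assume "p \<in> UNIV \<times> carrier_vec (r' + s')"
      then obtain v w where p: "p = (v, w)" and w: "w \<in> carrier_vec (r' + s')" by blast
      obtain x where x: "v = A x" using A(2) by (metis bij_pointE)
      have "w - B x \<in> carrier_vec (r' + s')" using w Bc by simp
      then obtain z where z: "z \<in> carrier_vec (r + s)" "C z = w - B x"
        using bij_C by (metis bij_betw_def imageE)
      have "B x + C z = w"
        unfolding z(2) using w Bc[of x] by (intro eq_vecI) auto
      then have "p = block_map A B C (x, z)" by (simp add: p x block_map_def)
      then show "p \<in> block_map A B C ` (UNIV \<times> carrier_vec (r + s))" using z(1) by blast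
    qed
  qed
  moreover have "B (x + y) + C (z + w) = (B x + C z) + (B y + C w)"
    if z: "z \<in> carrier_vec (r + s)" and w: "w \<in> carrier_vec (r + s)" for x y z w
    unfolding linear_on_add[OF C z w] linear_on_add[OF B(1) UNIV_I UNIV_I]
    using Bc[of x] Bc[of y] C_carrier[OF z] C_carrier[OF w]
    by (intro eq_vecI) auto
  moreover have "B (c *\<^sub>R x) + C (c \<cdot>\<^sub>v z) = c \<cdot>\<^sub>v (B x + C z)"
    if z: "z \<in> carrier_vec (r + s)" for c x z
    unfolding linear_on_scale[OF C z] linear_on_scale[OF B(1) UNIV_I]
    using Bc[of x] C_carrier[OF z] by (simp add: smult_add_distrib_vec)
  moreover have "B 0 + C (h_bracket r s bU J x y) = h_bracket r' s' bV J' (A x) (A y)" for x y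
    using h_bracket(1)[OF V] by (simp add: bracket linear_on_UNIV_0[OF B])
  ultimately show ?thesis
    by (auto simp: lie_algebra_iso_def pseudo_H_type_def bij_betw_def linear_on_def block_map_def
        linear_add[OF A(1)] linear_scale[OF A(1)] linear_0[OF A(1)])
qed

text \<open>The bracket relation is paired with \<open>z\<close>, and \<open>A\<close> and
  \<open>C\<close> are moved across the scalar products. Pairings with all \<open>A y\<close>
  determine the value of the adjoint.\<close>

lemma adjoint_intertwines:
  assumes z: "z \<in> carrier_vec (r' + s')"
  shows "At \<circ> J' z \<circ> A = J (Ct z)"
proof (rule ext)
  fix x
  have "bV (A y) (J' z (A x)) = bU y (J (Ct z) x)" for y
  proof -
    have sym: "bV u v = bV v u" "bU u' v' = bU v' u'" for u v u' v'
      using admissible_moduleD(2)[OF U] admissible_moduleD(2)[OF V]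
      by (auto simp: scalar_product_def)
    have "bV (A y) (J' z (A x)) = scalar_rs r' s' z (C (h_bracket r s bU J x y))"
      using h_bracket(2)[OF V z, of "A x" "A y"] by (simp add: bracket sym(1)[of "A y"])
    also have "\<dots> = scalar_rs r s (h_bracket r s bU J x y) (Ct z)"
      using Ct(2)[OF _ z h_bracket(1)[OF U]] by (simp add: scalar_rs_commute[of r' s' z])
    also have "\<dots> = bU (J (Ct z) x) y"
      using h_bracket(2)[OF U Ct(1)[OF _ z]] by (simp add: scalar_rs_commute[of r s "Ct z"])
    finally show ?thesis by (simp add: sym(2)[of y])
  qed
  then show "(At \<circ> J' z \<circ> A) x = J (Ct z) x"
    using At(2) by simp
qed

section \<open>Rescaling, determinants and signatures\<close>

lemma scaled:
  assumes "c \<noteq> 0"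
  shows "graded_iso r s r' s' bU bV J J' (\<lambda>x. c *\<^sub>R A x) (\<lambda>z. c\<^sup>2 \<cdot>\<^sub>v C z)"
proof (rule graded_iso.intro)
  show "linear (\<lambda>x. c *\<^sub>R A x)" by (rule linear_compose_scale_right[OF A(1)])
  show "bij (\<lambda>x. c *\<^sub>R A x)"
  proof (rule o_bij)
    show "(\<lambda>v. inv_into UNIV A ((1 / c) *\<^sub>R v)) \<circ> (\<lambda>x. c *\<^sub>R A x) = id"
      using A(2) assms by (auto simp: fun_eq_iff bij_def)
    show "(\<lambda>x. c *\<^sub>R A x) \<circ> (\<lambda>v. inv_into UNIV A ((1 / c) *\<^sub>R v)) = id"
      using A(2) assms by (auto simp: fun_eq_iff bij_def surj_f_inv_f)
  qed
  show "linear_on (carrier_vec (r + s)) (\<cdot>\<^sub>v) (\<cdot>\<^sub>v) (\<lambda>z. c\<^sup>2 \<cdot>\<^sub>v C z)"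
    using C smult_add_distrib_vec[OF C_carrier C_carrier]
    by (auto simp: linear_on_def smult_smult_assoc mult.commute)
  have inv: "d \<cdot>\<^sub>v (e \<cdot>\<^sub>v z) = z" if "d * e = 1" for d e :: real and z
    using that by (simp add: smult_smult_assoc)
  have C': "C (d \<cdot>\<^sub>v z) = d \<cdot>\<^sub>v C z" if "z \<in> carrier_vec (r + s)" for d z
    by (rule linear_on_scale[OF C that])
  let ?D = "\<lambda>w. inv_into (carrier_vec (r + s)) C ((1 / c\<^sup>2) \<cdot>\<^sub>v w)"
  show "bij_betw (\<lambda>z. c\<^sup>2 \<cdot>\<^sub>v C z) (carrier_vec (r + s)) (carrier_vec (r' + s'))"
  proof (rule bij_betw_byWitness[where f' = ?D])
    show "\<forall>z \<in> carrier_vec (r + s). ?D (c\<^sup>2 \<cdot>\<^sub>v C z) = z"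
      using assms bij_betw_inv_into_left[OF bij_C] by (simp add: inv)
    show "\<forall>w \<in> carrier_vec (r' + s'). c\<^sup>2 \<cdot>\<^sub>v C (?D w) = w"
      using assms bij_betw_inv_into_right[OF bij_C] by (simp add: inv)
    show "(\<lambda>z. c\<^sup>2 \<cdot>\<^sub>v C z) ` carrier_vec (r + s) \<subseteq> carrier_vec (r' + s')"
      using C_carrier by auto
    show "?D ` carrier_vec (r' + s') \<subseteq> carrier_vec (r + s)"
      using bij_betw_apply[OF bij_betw_inv_into[OF bij_C]] by auto
  qed
  fix x y
  \<comment> \<open>The bracket is linear in each argument, so scaling \<open>A\<close> by
    \<open>c\<close> costs exactly the factor \<open>c\<^sup>2\<close> placed on
    \<open>C\<close>.\<close>
  have "h_bracket r' s' bV J' (c *\<^sub>R A x) (c *\<^sub>R A y) = c\<^sup>2 \<cdot>\<^sub>v h_bracket r' s' bV J' (A x) (A y)"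
  proof (rule h_bracket(3)[OF V])
    fix z :: "real vec" assume z: "z \<in> carrier_vec (r' + s')"
    have l: "linear (bV u)" "linear (\<lambda>u. bV u v)" for u v
      using admissible_moduleD(2)[OF V] by (auto simp: scalar_product_def)
    show "bV (J' z (c *\<^sub>R A x)) (c *\<^sub>R A y)
        = scalar_rs r' s' z (c\<^sup>2 \<cdot>\<^sub>v h_bracket r' s' bV J' (A x) (A y))"
      using linear_on_scale[OF functional_on_scalar_rs(2) h_bracket(1)[OF V]]
      by (simp add: linear_scale[OF admissible_moduleD(3)[OF V z]] linear_scale[OF l(1)]
          linear_scale[OF l(2)] h_bracket(2)[OF V z] power2_eq_square)
  qed (simp add: h_bracket(1)[OF V])
  then show "c\<^sup>2 \<cdot>\<^sub>v C (h_bracket r s bU J x y) = h_bracket r' s' bV J' (c *\<^sub>R A x) (c *\<^sub>R A y)"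
    by (simp add: bracket)
qed (use U V in auto)

text \<open>The adjoint is scaled by \<open>c\<close> as well, so the composition is scaled by
  \<open>c\<^sup>2\<close>.\<close>

lemma endo_det_scaled:
  "endo_det ((\<lambda>x. c *\<^sub>R A x) \<circ> form_adjoint UNIV bU bV (\<lambda>x. c *\<^sub>R A x))
    = c ^ (2 * dim (UNIV :: 'v set)) * endo_det (A \<circ> At)"
proof -
  have l: "linear (bU u)" "linear (\<lambda>u. bV u v)" for u v
    using admissible_moduleD(2)[OF U] admissible_moduleD(2)[OF V] by (auto simp: scalar_product_def)
  have "form_adjoint UNIV bU bV (\<lambda>x. c *\<^sub>R A x) y = c *\<^sub>R At y" for y
    by (rule form_adjoint_UNIV(2)[OF admissible_moduleD(1,2)[OF U] admissible_moduleD(2)[OF V]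
          linear_compose_scale_right[OF A(1)]])
      (simp add: linear_scale[OF l(1)] linear_scale[OF l(2)] At(1))
  then have "(\<lambda>x. c *\<^sub>R A x) \<circ> form_adjoint UNIV bU bV (\<lambda>x. c *\<^sub>R A x) = (\<lambda>y. c\<^sup>2 *\<^sub>R y) \<circ> (A \<circ> At)"
    by (auto simp: fun_eq_iff linear_scale[OF A(1)] power2_eq_square)
  then show ?thesis
    using endo_det_compose[OF admissible_moduleD(1)[OF V] linear_scale_self linear_compose[OF linear_At A(1)], of "c\<^sup>2"]
    by (simp add: endo_det_scaleR[OF admissible_moduleD(1)[OF V]] power_mult)
qed

lemma endo_det_A_At_nonzero: "endo_det (A \<circ> At) \<noteq> 0"
proof (rule endo_det_nonzero[OF admissible_moduleD(1)[OF V] linear_compose[OF linear_At A(1)]])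
  show "inj (A \<circ> At)"
    using inj_form_adjoint_UNIV[OF admissible_moduleD(1,2)[OF U] admissible_moduleD(2)[OF V] A(1)] A(2)
    by (simp add: bij_def inj_compose)
qed

lemma abs_scalar_eq:
  assumes det: "\<bar>endo_det (A \<circ> At)\<bar> = 1" and nontriv: "\<exists>v :: 'v. v \<noteq> 0"
    and z: "z \<in> carrier_vec (r' + s')"
  shows "\<bar>scalar_rs r s (Ct z) (Ct z)\<bar> = \<bar>scalar_rs r' s' z z\<bar>"
proof -
  let ?n = "dim (UNIV :: 'v set)"
  let ?q = "scalar_rs r s (Ct z) (Ct z)" and ?q' = "scalar_rs r' s' z z"
  note fd = admissible_moduleD(1)[OF V]
  have Ctz: "Ct z \<in> carrier_vec (r + s)" by (rule Ct(1)[OF _ z])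
  have J': "linear (J' z)" by (rule admissible_moduleD(3)[OF V z])
  obtain g where g: "linear g" "g \<circ> A = id"
    using linear_injective_left_inverse[OF A(1)] A(2) by (auto simp: bij_def)
  have gA: "g (A x) = x" for x using g(2) by (simp add: fun_eq_iff)
  have Ag: "A (g v) = v" for v using gA A(2) by (metis bij_pointE)
  \<comment> \<open>The relation of \<open>adjoint_intertwines\<close> lives on \<open>U\<close>,
    but the determinants are compared on \<open>V\<close>. \<open>M\<close> is
    \<open>J (Ct z)\<close> transported to \<open>V\<close> by \<open>A\<close>, with
    \<open>g\<close> as inverse of \<open>A\<close>.\<close>
  define M where "M = A \<circ> (J (Ct z) \<circ> g)"
  have M: "linear M"
    unfolding M_def
    by (intro linear_compose A(1) g(1) admissible_moduleD(3)[OF U Ctz])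
  have "(A \<circ> At) \<circ> J' z = M"
    using adjoint_intertwines[OF z, symmetric] by (simp add: M_def fun_eq_iff Ag)
  then have "endo_det (A \<circ> At) * endo_det (J' z) = endo_det M"
    using endo_det_compose[OF fd linear_compose[OF linear_At A(1)] J'] by simp
  \<comment> \<open>The determinant is 1 or -1, and squaring removes this sign. Squaring also
    replaces \<open>J' z\<close> and \<open>M\<close> by their squares, which are scalar
    maps.\<close>
  moreover have "(endo_det (A \<circ> At))\<^sup>2 = 1" using det by (simp add: power2_eq_1_iff abs_if split: if_splits)
  ultimately have "(endo_det (J' z))\<^sup>2 = (endo_det M)\<^sup>2"
    by (metis mult_1 power_mult_distrib)
  moreover have "(endo_det (J' z))\<^sup>2 = (- ?q') ^ ?n"
  proof -
    have "J' z \<circ> J' z = (\<lambda>x. - ?q' *\<^sub>R x)"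
      using admissible_moduleD(5)[OF V z] by (auto simp: fun_eq_iff)
    then show ?thesis
      using endo_det_compose[OF fd J' J'] endo_det_scaleR[OF fd] by (metis power2_eq_square)
  qed
  moreover have "(endo_det M)\<^sup>2 = (- ?q) ^ ?n"
  proof -
    have "M \<circ> M = (\<lambda>x. - ?q *\<^sub>R x)"
      using admissible_moduleD(5)[OF U Ctz]
      by (simp add: M_def fun_eq_iff gA Ag linear_neg[OF A(1)] linear_scale[OF A(1)])
    then show ?thesis
      using endo_det_compose[OF fd M M] endo_det_scaleR[OF fd] by (metis power2_eq_square)
  qed
  ultimately have "(- ?q') ^ ?n = (- ?q) ^ ?n" by simp
  \<comment> \<open>The bases are made nonnegative before the exponent is cancelled, since an even
    power does not see the sign.\<close>
  then have "\<bar>?q'\<bar> ^ ?n = \<bar>?q\<bar> ^ ?n" by (metis abs_minus_cancel power_abs)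
  then show ?thesis
    using power_eq_iff_eq_base[OF dim_UNIV_pos[OF fd nontriv]] by (metis abs_ge_zero)
qed

text \<open>The form pulled back along \<open>Ct\<close> has the same absolute values on the
  diagonal as \<open>scalar_rs r' s'\<close>, so \<open>forms_equal_up_to_sign\<close> makes
  \<open>Ct\<close> an isometry or an anti-isometry.\<close>

lemma scalar_Ct:
  assumes "\<bar>endo_det (A \<circ> At)\<bar> = 1" "\<exists>v :: 'v. v \<noteq> 0"
  obtains \<sigma> where "\<sigma> = 1 \<or> \<sigma> = - 1"
    and "\<And>z w. z \<in> carrier_vec (r' + s') \<Longrightarrow> w \<in> carrier_vec (r' + s') \<Longrightarrow>
      scalar_rs r s (Ct z) (Ct w) = \<sigma> * scalar_rs r' s' z w"
proof -
  have "functional_on (r' + s') (\<lambda>z. scalar_rs r s (Ct z) (Ct w))" for w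
    using linear_on_form_adjoint_rs[OF C C_carrier] functional_on_scalar_rs(1)[of r s "Ct w"] Ct(1)
    by (simp add: linear_on_def)
  then show ?thesis
    using forms_equal_up_to_sign[of "r' + s'" "\<lambda>z w. scalar_rs r s (Ct z) (Ct w)" "scalar_rs r' s'"]
      functional_on_scalar_rs(1) scalar_rs_commute abs_scalar_eq[OF assms] that
    by blast
qed

text \<open>Paired with \<open>w\<close>, the vector \<open>C (Ct z)\<close> gives the product of
  \<open>Ct z\<close> and \<open>Ct w\<close>; non-degeneracy then identifies it.\<close>

lemma C_Ct:
  assumes "\<And>z w. z \<in> carrier_vec (r' + s') \<Longrightarrow> w \<in> carrier_vec (r' + s') \<Longrightarrow>
      scalar_rs r s (Ct z) (Ct w) = \<sigma> * scalar_rs r' s' z w"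
    and z: "z \<in> carrier_vec (r' + s')"
  shows "C (Ct z) = \<sigma> \<cdot>\<^sub>v z"
proof (rule scalar_rs_eqI)
  have Ctz: "Ct z \<in> carrier_vec (r + s)" by (rule Ct(1)[OF _ z])
  then show "C (Ct z) \<in> carrier_vec (r' + s')" by (rule C_carrier)
  show "\<sigma> \<cdot>\<^sub>v z \<in> carrier_vec (r' + s')" using z by simp
  fix w :: "real vec" assume w: "w \<in> carrier_vec (r' + s')"
  have "scalar_rs r' s' w (C (Ct z)) = scalar_rs r s (Ct z) (Ct w)"
    using Ct(2)[OF _ w Ctz] by (simp add: scalar_rs_commute[of r' s' w])
  also have "\<dots> = scalar_rs r' s' w (\<sigma> \<cdot>\<^sub>v z)"
    using linear_on_scale[OF functional_on_scalar_rs(2) z] assms(1)[OF z w]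
    by (simp add: scalar_rs_commute[of r' s' z])
  finally show "scalar_rs r' s' w (C (Ct z)) = scalar_rs r' s' w (\<sigma> \<cdot>\<^sub>v z)" .
qed

text \<open>\<open>signature_le\<close> gives inequalities in one direction only; equality of the
  total dimensions turns them into equalities.\<close>

lemma signature:
  assumes "\<sigma> = 1 \<or> \<sigma> = - 1" "r + s = r' + s'"
    and "\<And>z w. z \<in> carrier_vec (r' + s') \<Longrightarrow> w \<in> carrier_vec (r' + s') \<Longrightarrow>
      scalar_rs r s (Ct z) (Ct w) = \<sigma> * scalar_rs r' s' z w"
  shows "(r, s) = (r', s') \<or> (r, s) = (s', r')"
  using signature_le[OF linear_on_form_adjoint_rs[OF C C_carrier] Ct(1) assms(3)] assms(1,2)
  by fastforce

end

section \<open>Block triangular form of an arbitrary isomorphism\<close>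

lemma lie_algebra_iso_decompose:
  fixes bU :: "'u::real_vector \<Rightarrow> 'u \<Rightarrow> real" and bV :: "'v::real_vector \<Rightarrow> 'v \<Rightarrow> real"
  assumes U: "admissible_module r s bU J" and V: "admissible_module r' s' bV J'"
    and dims: "r + s = r' + s'"
    and iso: "lie_algebra_iso (pseudo_H_type r s bU J) (pseudo_H_type r' s' bV J') \<Phi>"
  defines "A \<equiv> \<lambda>x. fst (\<Phi> (x, 0\<^sub>v (r + s)))"
    and "B \<equiv> \<lambda>x. snd (\<Phi> (x, 0\<^sub>v (r + s)))"
    and "C \<equiv> \<lambda>z. snd (\<Phi> (0, z))"
  shows "graded_iso r s r' s' bU bV J J' A C"
    and "linear_on UNIV (*\<^sub>R) (\<cdot>\<^sub>v) B" "range B \<subseteq> carrier_vec (r' + s')"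
    and "z \<in> carrier_vec (r + s) \<Longrightarrow> \<Phi> (x, z) = block_map A B C (x, z)"
proof -
  let ?K = "carrier_vec (r + s) :: real vec set" and ?K' = "carrier_vec (r' + s') :: real vec set"
  let ?o = "0\<^sub>v (r + s) :: real vec" and ?o' = "0\<^sub>v (r' + s') :: real vec"
  let ?h = "h_bracket r s bU J" and ?h' = "h_bracket r' s' bV J'"
  have bij: "bij_betw \<Phi> (UNIV \<times> ?K) (UNIV \<times> ?K')"
    using iso by (simp add: lie_algebra_iso_def pseudo_H_type_def)
  have lin: "linear_on (UNIV \<times> ?K) (\<lambda>c (x, z). (c *\<^sub>R x, c \<cdot>\<^sub>v z)) (\<lambda>c (x, z). (c *\<^sub>R x, c \<cdot>\<^sub>v z)) \<Phi>"
    using iso by (simp add: lie_algebra_iso_def pseudo_H_type_def)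
  have add: "\<Phi> (x + y, z + w) = \<Phi> (x, z) + \<Phi> (y, w)" if "z \<in> ?K" "w \<in> ?K" for x y z w
    using linear_on_add[OF lin, of "(x, z)" "(y, w)"] that by simp
  have scale: "\<Phi> (c *\<^sub>R x, c \<cdot>\<^sub>v z) = (c *\<^sub>R fst (\<Phi> (x, z)), c \<cdot>\<^sub>v snd (\<Phi> (x, z)))"
    if "z \<in> ?K" for c x z
    using linear_on_scale[OF lin, of "(x, z)" c] that by (simp add: split_beta)
  have "\<Phi> (lie_bracket (pseudo_H_type r s bU J) p q)
      = lie_bracket (pseudo_H_type r' s' bV J') (\<Phi> p) (\<Phi> q)"
    if "p \<in> lie_carrier (pseudo_H_type r s bU J)" "q \<in> lie_carrier (pseudo_H_type r s bU J)" for p q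
    using iso that unfolding lie_algebra_iso_def by blast
  note brk' = this
  \<comment> \<open>Brackets depend on first components only, so the central parts \<open>z\<close>
    and \<open>w\<close> can be chosen freely.\<close>
  have brk: "\<Phi> (0, ?h x y) = (0, ?h' (fst (\<Phi> (x, z))) (fst (\<Phi> (y, w))))"
    if "z \<in> ?K" "w \<in> ?K" for x y z w
    using brk'[of "(x, z)" "(y, w)"] that by (simp add: pseudo_H_type_def split_beta)
  have K': "snd (\<Phi> (x, z)) \<in> ?K'" if "z \<in> ?K" for x z
    using bij_betw_apply[OF bij, of "(x, z)"] that by auto
  have inj: "x = y \<and> z = w" if "\<Phi> (x, z) = \<Phi> (y, w)" "z \<in> ?K" "w \<in> ?K" for x y z w
    using inj_onD[OF bij_betw_imp_inj_on[OF bij] that(1)] that(2,3) by auto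
  have surj: "\<exists>x z. z \<in> ?K \<and> \<Phi> (x, z) = (v, w)" if "w \<in> ?K'" for v w
  proof -
    have "(v, w) \<in> \<Phi> ` (UNIV \<times> ?K)" using that by (simp add: bij_betw_imp_surj_on[OF bij])
    then obtain p where p: "p \<in> UNIV \<times> ?K" "(v, w) = \<Phi> p" by (rule imageE)
    then show ?thesis by (intro exI[of _ "fst p"] exI[of _ "snd p"]) auto
  qed
  have o: "?o \<in> ?K" "?o' \<in> ?K'" by simp_all
  have smult0: "0 \<cdot>\<^sub>v z = 0\<^sub>v n" if "z \<in> carrier_vec n" for z :: "real vec" and n
    using that by auto
  have \<Phi>0: "\<Phi> (0, ?o) = (0, ?o')"
    using scale[OF o(1), of 0 0] smult0[OF o(1)] smult0[OF K'[OF o(1)]] by simp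
  \<comment> \<open>The centre goes into the centre. By surjectivity every \<open>v\<close> is the
    first component of some image, and \<open>(0, z)\<close> commutes with everything, so the first
    component of its image is killed by \<open>h_bracket_nondegenerate\<close>. For
    \<open>r + s = 0\<close> the only \<open>z\<close> is the zero vector.\<close>
  have \<Phi>_fst: "fst (\<Phi> (0, z)) = 0" if z: "z \<in> ?K" for z
  proof (cases "r + s = 0")
    case True
    then have "z = ?o" using z by auto
    then show ?thesis by (simp add: \<Phi>0)
  next
    case False
    have "?h' (fst (\<Phi> (0, z))) v = ?o'" for v
    proof -
      obtain y w where "w \<in> ?K" "\<Phi> (y, w) = (v, ?o')" using surj[OF o(2)] by blast
      with brk[OF z, of w 0 y] show ?thesis by (simp add: h_bracket_0_left[OF U] \<Phi>0)
    qed
    then show ?thesis using h_bracket_nondegenerate[OF V] False dims by simp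
  qed
  have \<Phi>C: "\<Phi> (0, z) = (0, C z)" if "z \<in> ?K" for z
    using \<Phi>_fst[OF that] by (simp add: C_def prod_eq_iff)
  \<comment> \<open>If \<open>A x = 0\<close>, then \<open>\<Phi>\<close> sends every bracket with
    \<open>x\<close> to zero, so \<open>x\<close> commutes with everything. For
    \<open>r + s = 0\<close> the second component of the image is zero too, and injectivity of
    \<open>\<Phi>\<close> applies at once.\<close>
  have A0: "x = 0" if x: "A x = 0" for x
  proof (cases "r + s = 0")
    case True
    then have "snd (\<Phi> (x, ?o)) = ?o'" using K'[OF o(1), of x] dims by auto
    then have "\<Phi> (x, ?o) = \<Phi> (0, ?o)" using x by (simp add: \<Phi>0 A_def prod_eq_iff)
    then show ?thesis using inj o by blast
  next
    case False
    have "?h x y = ?o" for y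
    proof -
      have "\<Phi> (0, ?h x y) = \<Phi> (0, ?o)"
        using brk[OF o(1) o(1), of x y] x by (simp add: \<Phi>0 A_def h_bracket_0_left[OF V])
      then show ?thesis using inj h_bracket(1)[OF U] o(1) by blast
    qed
    then show ?thesis using h_bracket_nondegenerate[OF U] False by simp
  qed
  have oo: "?o + ?o = ?o" "c \<cdot>\<^sub>v ?o = ?o" for c by auto
  have A_add: "A (x + y) = A x + A y" and B_add: "B (x + y) = B x + B y" for x y
    using add[OF o(1) o(1), of x y] by (simp_all add: A_def B_def oo(1))
  have A_scale: "A (c *\<^sub>R x) = c *\<^sub>R A x" and B_scale: "B (c *\<^sub>R x) = c \<cdot>\<^sub>v B x" for c x
    using scale[OF o(1), of c x] by (simp_all add: A_def B_def oo(2))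
  have A: "linear A" by (rule linearI) (fact A_add A_scale)+
  show block: "\<Phi> (x, z) = block_map A B C (x, z)" if z: "z \<in> ?K" for x z
  proof -
    have "\<Phi> (x, z) = \<Phi> (x, ?o) + \<Phi> (0, z)" using add[OF o(1) z, of x 0] z by simp
    then show ?thesis using \<Phi>C[OF z] by (simp add: block_map_def A_def B_def prod_eq_iff)
  qed
  show "linear_on UNIV (*\<^sub>R) (\<cdot>\<^sub>v) B" "range B \<subseteq> ?K'"
    using B_add B_scale K'[OF o(1)] by (auto simp: linear_on_def B_def)
  show "graded_iso r s r' s' bU bV J J' A C"
  proof (rule graded_iso.intro[OF U V A])
    have "surj A"
      unfolding surj_def
    proof
      fix v
      obtain x z where "z \<in> ?K" "\<Phi> (x, z) = (v, ?o')" using surj[OF o(2)] by blast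
      then show "\<exists>x. v = A x" using block[of z x] by (auto simp: block_map_def)
    qed
    moreover have "inj A" using A0 linear_injective_0[OF A] by blast
    ultimately show "bij A" by (simp add: bij_def)
    show "linear_on ?K (\<cdot>\<^sub>v) (\<cdot>\<^sub>v) C"
      unfolding linear_on_def
    proof (intro conjI ballI allI)
      fix z w assume "z \<in> ?K" "w \<in> ?K"
      then show "C (z + w) = C z + C w" using add[of z w 0 0] by (simp add: C_def)
    next
      fix c z assume "z \<in> ?K"
      then show "C (c \<cdot>\<^sub>v z) = c \<cdot>\<^sub>v C z" using scale[of z c 0] by (simp add: C_def)
    qed
    show "bij_betw C ?K ?K'"
      unfolding bij_betw_def
    proof (intro conjI inj_onI subset_antisym subsetI)
      fix z w assume "z \<in> ?K" "w \<in> ?K" "C z = C w"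
      then show "z = w" using inj[of 0 z 0 w] \<Phi>C by simp
    next
      fix w assume "w \<in> C ` ?K"
      then show "w \<in> ?K'" using K' by (auto simp: C_def)
    next
      fix w assume "w \<in> ?K'"
      then obtain x z where xz: "z \<in> ?K" "\<Phi> (x, z) = (0, w)" using surj by blast
      \<comment> \<open>A preimage of a central vector has \<open>A x = 0\<close>, hence lies in the
        centre itself; this gives surjectivity of \<open>C\<close>.\<close>
      then have "A x = 0" using block[of z x] by (simp add: block_map_def)
      then have "x = 0" by (rule A0)
      then show "w \<in> C ` ?K" using xz \<Phi>C[OF xz(1)] by auto
    qed
    show "C (?h x y) = ?h' (A x) (A y)" for x y
      using brk[OF o(1) o(1), of x y] by (simp add: C_def A_def)
  qed
qed

section \<open>Signatures, block form and normalisation of an isomorphism\<close>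

theorem theorem2:
  fixes r s r' s' :: nat
    and bU :: "'u::real_vector \<Rightarrow> 'u \<Rightarrow> real"
    and bV :: "'v::real_vector \<Rightarrow> 'v \<Rightarrow> real"
    and J :: "real vec \<Rightarrow> 'u \<Rightarrow> 'u"
    and J' :: "real vec \<Rightarrow> 'v \<Rightarrow> 'v"
    and \<Phi> :: "'u \<times> real vec \<Rightarrow> 'v \<times> real vec"
  assumes "admissible_module r s bU J"
    and "admissible_module r' s' bV J'"
    and "\<exists>x::'u. x \<noteq> 0"
    and "dim (UNIV :: 'u set) = dim (UNIV :: 'v set)"
    and "r + s = r' + s'"
    and "lie_algebra_iso (pseudo_H_type r s bU J) (pseudo_H_type r' s' bV J') \<Phi>"
  shows "((r, s) = (r', s') \<or> (r, s) = (s', r')) \<and>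
    (\<exists>A B C.
      linear A \<and> bij A \<and>
      linear_on UNIV (*\<^sub>R) (\<cdot>\<^sub>v) B \<and> range B \<subseteq> carrier_vec (r' + s') \<and>
      linear_on (carrier_vec (r + s)) (\<cdot>\<^sub>v) (\<cdot>\<^sub>v) C \<and>
      bij_betw C (carrier_vec (r + s)) (carrier_vec (r' + s')) \<and>
      (\<forall>x. \<forall>z \<in> carrier_vec (r + s). \<Phi> (x, z) = block_map A B C (x, z)) \<and>
      (\<forall>z \<in> carrier_vec (r' + s').
         form_adjoint UNIV bU bV A \<circ> J' z \<circ> A
         = J (form_adjoint (carrier_vec (r + s)) (scalar_rs r s) (scalar_rs r' s') C z)) \<and>
      (\<forall>B'. linear_on UNIV (*\<^sub>R) (\<cdot>\<^sub>v) B' \<and> range B' \<subseteq> carrier_vec (r' + s') \<longrightarrow>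
         lie_algebra_iso (pseudo_H_type r s bU J) (pseudo_H_type r' s' bV J') (block_map A B' C)) \<and>
      lie_algebra_iso (pseudo_H_type r s bU J) (pseudo_H_type r' s' bV J')
        (block_map A (\<lambda>x. 0\<^sub>v (r' + s')) C) \<and>
      (\<exists>c::real. c \<noteq> 0 \<and>
        (let A' = (\<lambda>x. c *\<^sub>R A x);
             C' = (\<lambda>z. c\<^sup>2 \<cdot>\<^sub>v C z);
             A'\<tau> = form_adjoint UNIV bU bV A';
             C'\<tau> = form_adjoint (carrier_vec (r + s)) (scalar_rs r s) (scalar_rs r' s') C'
         in (\<forall>B'. linear_on UNIV (*\<^sub>R) (\<cdot>\<^sub>v) B' \<and> range B' \<subseteq> carrier_vec (r' + s') \<longrightarrow>
               lie_algebra_iso (pseudo_H_type r s bU J) (pseudo_H_type r' s' bV J')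
                 (block_map A' B' C')) \<and>
            (\<forall>z \<in> carrier_vec (r' + s'). A'\<tau> \<circ> J' z \<circ> A' = J (C'\<tau> z)) \<and>
            \<bar>endo_det (A' \<circ> A'\<tau>)\<bar> = 1 \<and>
            ((\<forall>z \<in> carrier_vec (r' + s'). C' (C'\<tau> z) = z) \<or>
             (\<forall>z \<in> carrier_vec (r' + s'). C' (C'\<tau> z) = - z)))))"
proof -
  note decompose = lie_algebra_iso_decompose[OF assms(1,2,5,6)]
  obtain A B C where G: "graded_iso r s r' s' bU bV J J' A C"
    and B: "linear_on UNIV (*\<^sub>R) (\<cdot>\<^sub>v) B" "range B \<subseteq> carrier_vec (r' + s')"
    and block: "\<And>x z. z \<in> carrier_vec (r + s) \<Longrightarrow> \<Phi> (x, z) = block_map A B C (x, z)"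
    by (rule that[OF decompose(1-3)]) (rule decompose(4))
  interpret G: graded_iso r s r' s' bU bV J J' A C by (rule G)
  \<comment> \<open>Injectivity of \<open>A\<close> carries a nonzero vector of \<open>U\<close>
    over to \<open>V\<close>, whose dimension is the exponent below.\<close>
  have nontriv: "\<exists>v :: 'v. v \<noteq> 0"
  proof -
    obtain x :: 'u where "x \<noteq> 0" using assms(3) by blast
    then have "A x \<noteq> 0"
      using linear_injective_0[OF G.A(1)] bij_is_inj[OF G.A(2)] by blast
    then show ?thesis by blast
  qed
  define n where "n = dim (UNIV :: 'v set)"
  have n: "n > 0"
    unfolding n_def by (rule dim_UNIV_pos[OF admissible_moduleD(1)[OF assms(2)] nontriv])
  define d where "d = \<bar>endo_det (A \<circ> form_adjoint UNIV bU bV A)\<bar>"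
  have d: "d > 0" using G.endo_det_A_At_nonzero by (simp add: d_def)
  \<comment> \<open>By \<open>G.endo_det_scaled\<close> the factor \<open>c\<close> multiplies the
    determinant by \<open>c ^ (2 * n)\<close>, which has to cancel its absolute value
    \<open>d\<close>.\<close>
  define c where "c = root (2 * n) (1 / d)"
  have c: "c > 0" "c ^ (2 * n) = 1 / d"
    using n d by (simp_all add: c_def real_root_gt_zero)
  define A' where "A' = (\<lambda>x. c *\<^sub>R A x)"
  define C' where "C' = (\<lambda>z. c\<^sup>2 \<cdot>\<^sub>v C z)"
  \<comment> \<open>The rescaled pair is again a pair of diagonal blocks with the same
    \<open>r\<close>, \<open>s\<close>, \<open>r'\<close>, \<open>s'\<close>, so the comparison of
    signatures may be made after normalisation.\<close>
  interpret S: graded_iso r s r' s' bU bV J J' A' C'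
    unfolding A'_def C'_def by (rule G.scaled) (use c in simp)
  have det: "\<bar>endo_det (A' \<circ> form_adjoint UNIV bU bV A')\<bar> = 1"
    using G.endo_det_scaled[of c, folded A'_def n_def] c d by (simp add: abs_mult flip: d_def)
  obtain \<sigma> where \<sigma>: "\<sigma> = 1 \<or> \<sigma> = - 1"
    and Ct: "\<And>z w. z \<in> carrier_vec (r' + s') \<Longrightarrow> w \<in> carrier_vec (r' + s') \<Longrightarrow>
      scalar_rs r s (S.Ct z) (S.Ct w) = \<sigma> * scalar_rs r' s' z w"
    using S.scalar_Ct[OF det nontriv] by metis
  have sig: "(r, s) = (r', s') \<or> (r, s) = (s', r')"
    by (rule S.signature[OF \<sigma> assms(5) Ct])
  have "- 1 \<cdot>\<^sub>v z = - z" for z :: "real vec" by auto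
  then have CC: "(\<forall>z \<in> carrier_vec (r' + s'). C' (S.Ct z) = z) \<or>
      (\<forall>z \<in> carrier_vec (r' + s'). C' (S.Ct z) = - z)"
    using S.C_Ct[OF Ct] \<sigma> by (metis one_smult_vec)
  have B0: "linear_on UNIV (*\<^sub>R) (\<cdot>\<^sub>v) (\<lambda>x :: 'u. 0\<^sub>v (r' + s') :: real vec)"
    "range (\<lambda>x :: 'u. 0\<^sub>v (r' + s')) \<subseteq> (carrier_vec (r' + s') :: real vec set)"
    by (auto simp: linear_on_def)
  have "c \<noteq> 0" using c(1) by simp
  note scaled = this S.lie_algebra_iso_block_map S.adjoint_intertwines det CC
  show ?thesis
    unfolding Let_def
    by (intro conjI exI[of _ A] exI[of _ B] exI[of _ C] exI[of _ c] allI ballI impI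
        G.lie_algebra_iso_block_map[OF B0])
      (fact sig G.A B G.C G.bij_C scaled[unfolded A'_def C'_def]
        | blast intro: block G.adjoint_intertwines G.lie_algebra_iso_block_map
            scaled[unfolded A'_def C'_def])+
qed

end
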